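(* Let $\alpha\ge 0$, $\beta>0$ and let $f\in\mathcal B$ be a Bernstein function (not identically zero) such that $f(\alpha)>0$. Let $\kappa$ be the non-negative measure on $[0,\infty[$ determined by $$\frac{f'(s)}{f(s)}=\int_0^\infty e^{-sx}\,d\kappa(x),\qquad s>0.$$ The uniquely determined probability measure $\rho$ on $[0,\infty[$ with moments $$\int_0^\infty x^n\,d\rho(x)=s_n=f(\alpha)f(\alpha+\beta)\cdots f(\alpha+(n-1)\beta),\qquad n\ge 1,$$ is concentrated on $]0,\infty[$ and is infinitely divisible with respect to the product convolution. The unique product convolution semigroup $(\rho_c)_{c>0}$ with $\rho_1=\rho$ has the moments $$\int_0^\infty x^n\,d\rho_c(x)=\bigl(f(\alpha)f(\alpha+\beta)\cdots f(\alpha+(n-1)\beta)\bigr)^c,\qquad c>0,\ n=1,2,\ldots.$$ The Mellin transform of $\rho_c$ is given by $$\int_0^\infty t^z\,d\rho_c(t)=e^{-c\psi(z)},\qquad \operatorname{Re} z\ge 0,$$ where $$\psi(z)=-z\log f(\alpha)+\int_0^\infty\Bigl((1-e^{-z\beta x})-z(1-e^{-\beta x})\Bigr)\frac{e^{-\alpha x}}{x(1-e^{-\beta x})}\,d\kappa(x).$$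
   Context: A Bernstein function is a function of the form $f(s)=a+bs+\int_0^\infty(1-e^{-sx})\,d\nu(x)$, where $a,b\ge 0$ and $\nu$ is a non-negative measure on $]0,\infty[$ with $\int x/(1+x)\,d\nu(x)<\infty$; in particular $f(0)=a$. $\mathcal B$ denotes the set of Bernstein functions which are not identically zero. For $f\in\mathcal B$ the function $f'/f$ is completely monotonic on $]0,\infty[$, so the measure $\kappa$ exists and is unique, and it satisfies $\kappa(\{0\})=0$. It is a known result (Berg–Durán, Berg) that, with $s_0=1$, the sequence $(s_n)_{n\ge0}$ in the claim is the moment sequence of exactly one measure on $[0,\infty[$; this is the probability measure $\rho$ referred to in the claim. The product convolution $\mu\diamond\nu$ of two measures on $[0,\infty[$ is the image of the product measure $\mu\otimes\nu$ under the map $(s,t)\mapsto st$. A probability $\rho$ on $]0,\infty[$ is infinitely divisible with respect to the product convolution if for every natural number $p$ there is a probability $\tau(p)$ on $]0,\infty[$ with $(\tau(p))^{\diamond p}=\rho$ ($p$-fold product convolution). A product convolution semigroup is a family $(\rho_c)_{c>0}$ of probabilities on $]0,\infty[$ such that $\rho_c\diamond\rho_d=\rho_{c+d}$ for all $c,d>0$ and $c\mapsto\rho_c$ is weakly continuous. *)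

theory Defs
  imports "HOL-Probability.Probability"
begin

text \<open>A measure on a Borel set \<open>I\<close> of the real line is represented by the Borel measure on the
  whole line that vanishes outside \<open>I\<close>, so that measures on \<open>[0,\<infinity>[\<close> and on \<open>]0,\<infinity>[\<close> share one type
  and \<open>borel_measure_on {0<..} \<rho>\<close> says that \<open>\<rho>\<close> is concentrated on \<open>]0,\<infinity>[\<close>.\<close>

definition borel_measure_on :: "real set \<Rightarrow> real measure \<Rightarrow> bool" where
  "borel_measure_on I \<mu> \<longleftrightarrow> sets \<mu> = sets borel \<and> emeasure \<mu> (- I) = 0"

definition prob_on :: "real set \<Rightarrow> real measure \<Rightarrow> bool" where
  "prob_on I \<mu> \<longleftrightarrow> prob_space \<mu> \<and> borel_measure_on I \<mu>"

text \<open>Bernstein functions live on \<open>[0,\<infinity>[\<close>; their values at negative arguments are irrelevant.\<close>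

definition bernstein_function :: "(real \<Rightarrow> real) \<Rightarrow> bool" where
  "bernstein_function f \<longleftrightarrow>
    (\<exists>a b \<nu>. a \<ge> 0 \<and> b \<ge> 0 \<and> borel_measure_on {0<..} \<nu> \<and>
       integrable \<nu> (\<lambda>x. x / (1 + x)) \<and>
       (\<forall>s\<ge>0. f s = a + b * s + (\<integral>x. (1 - exp (- (s * x))) \<partial>\<nu>)))"

definition nonzero_bernstein_functions :: "(real \<Rightarrow> real) set" where
  "nonzero_bernstein_functions = {f. bernstein_function f \<and> (\<exists>s\<ge>0. f s \<noteq> 0)}"

definition has_moments :: "real measure \<Rightarrow> (nat \<Rightarrow> real) \<Rightarrow> bool" where
  "has_moments \<mu> s \<longleftrightarrow> (\<forall>n\<ge>1. has_bochner_integral \<mu> (\<lambda>x. x ^ n) (s n))"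

definition prod_convolution :: "real measure \<Rightarrow> real measure \<Rightarrow> real measure" where
  "prod_convolution \<mu> \<nu> = distr (\<mu> \<Otimes>\<^sub>M \<nu>) borel (\<lambda>(s, t). s * t)"

primrec prod_convolution_power :: "real measure \<Rightarrow> nat \<Rightarrow> real measure" where
  "prod_convolution_power \<mu> 0 = return borel 1"
| "prod_convolution_power \<mu> (Suc p) = prod_convolution \<mu> (prod_convolution_power \<mu> p)"

text \<open>The empty power is the unit mass at 1, so \<open>p\<close> ranges over the positive integers.\<close>

definition prod_infinitely_divisible :: "real measure \<Rightarrow> bool" where
  "prod_infinitely_divisible \<rho> \<longleftrightarrow> prob_on {0<..} \<rho> \<and>
    (\<forall>p\<ge>1. \<exists>\<tau>. prob_on {0<..} \<tau> \<and> prod_convolution_power \<tau> p = \<rho>)"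

text \<open>A family indexed by \<open>]0,\<infinity>[\<close> is a function on the reals of which only the values at positive
  arguments matter. Weak continuity is tested on bounded continuous functions on \<open>]0,\<infinity>[\<close>.\<close>

definition prod_convolution_semigroup :: "(real \<Rightarrow> real measure) \<Rightarrow> bool" where
  "prod_convolution_semigroup \<rho> \<longleftrightarrow>
    (\<forall>c>0. prob_on {0<..} (\<rho> c)) \<and>
    (\<forall>c>0. \<forall>d>0. prod_convolution (\<rho> c) (\<rho> d) = \<rho> (c + d)) \<and>
    (\<forall>g :: real \<Rightarrow> real. continuous_on {0<..} g \<and> bounded (g ` {0<..}) \<longrightarrow>
       continuous_on {0<..} (\<lambda>c. LINT x:{0<..}|\<rho> c. g x))"

definition mellin_integrand :: "real \<Rightarrow> real \<Rightarrow> complex \<Rightarrow> real \<Rightarrow> complex" where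
  "mellin_integrand \<alpha> \<beta> z x =
    ((1 - exp (- z * of_real (\<beta> * x))) - z * of_real (1 - exp (- \<beta> * x)))
      * of_real (exp (- \<alpha> * x) / (x * (1 - exp (- \<beta> * x))))"

text \<open>The value of the integrand at \<open>x = 0\<close> (0 by the convention for division) does not matter,
  since the measure \<open>\<kappa>\<close> it is integrated against has no mass at 0.\<close>

definition mellin_exponent ::
    "(real \<Rightarrow> real) \<Rightarrow> real \<Rightarrow> real \<Rightarrow> real measure \<Rightarrow> complex \<Rightarrow> complex" where
  "mellin_exponent f \<alpha> \<beta> \<kappa> z =
    - z * of_real (ln (f \<alpha>)) + (\<integral>x. mellin_integrand \<alpha> \<beta> z x \<partial>\<kappa>)"

end

theory Submission imports Defs begin

text \<open>
  Substituting \<open>w = e\<^sup>-\<^sup>\<beta>\<^sup>x\<close> turns the exponent into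
  \<open>- \<psi>(z) = z L + \<integral> (w\<^sup>z - 1 + z (1 - w)) / (1 - w)\<^sup>2 d\<eta>(w)\<close>, where \<open>L = log f(\<alpha>)\<close> and \<open>\<eta>\<close>
  is a finite measure on \<open>]0,1[\<close>: the image of \<open>(e\<^sup>-\<^sup>\<alpha>\<^sup>x - e\<^sup>-\<^sup>(\<^sup>\<alpha>\<^sup>+\<^sup>\<beta>\<^sup>)\<^sup>x) / x d\<kappa>(x)\<close>, whose total mass is
  \<open>log f(\<alpha> + \<beta>) - log f(\<alpha>)\<close> because integrating \<open>f'/f = \<integral> e\<^sup>-\<^sup>s\<^sup>x d\<kappa>(x)\<close> over \<open>s\<close> gives the increments
  of \<open>log f\<close> (lemma \<open>log_increment\<close>). This is the Levy-Khintchine exponent, with compensated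
  jumps \<open>log w < 0\<close>, of the logarithm of a positive random variable. So for every \<open>c > 0\<close> there
  should be a probability \<open>\<rho>\<^sub>c\<close> on \<open>]0,\<infinity>[\<close> with Mellin transform \<open>e\<^sup>-\<^sup>c\<^sup>\<psi>\<close>.

  It is constructed in multiplicative form (lemma \<open>exists_mellin\<close>). Cutting \<open>\<eta>\<close> off near \<open>w = 1\<close>
  makes \<open>(1 - w)\<^sup>-\<^sup>2 d\<eta>\<close> finite, and the exponent is then that of a constant times a product of
  Poisson many independent factors in \<open>]0,1[\<close>. All these approximations have mean \<open>e\<^sup>c\<^sup>L\<close> and
  bounded moments of every order, so Helly's theorem gives a weak limit whose Mellin transform is
  the limit of theirs on \<open>Re z > 0\<close>. Letting \<open>z \<rightarrow> 0\<close> there shows that the limit has no mass at 0,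
  and dominated convergence extends the formula to \<open>Re z = 0\<close>.

  Mellin transforms on the imaginary axis are the characteristic functions of the logarithms, so
  they determine the measures, turn the product convolution into a product, and yield weak
  continuity through Levy's theorem; hence \<open>(\<rho>\<^sub>c)\<close> is a product convolution semigroup. At an integer
  \<open>n\<close> the kernel above is \<open>\<Sum>\<^sub>k\<^sub><\<^sub>n (1 - w\<^sup>k) / (1 - w)\<close>, so \<open>- \<psi>(n) = \<Sum>\<^sub>k\<^sub><\<^sub>n log f(\<alpha> + k \<beta>)\<close>
  and \<open>\<rho>\<^sub>c\<close> has the moments \<open>s\<^sub>n\<^sup>c\<close>.

  A Bernstein function grows at most linearly, so \<open>s\<^sub>n \<le> K\<^sup>n n!\<close>, and such moments determine the
  measure (lemma \<open>stieltjes_moment_determinacy\<close>). This gives the uniqueness of \<open>\<rho>\<close>. It also gives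
  that of the semigroup: any other semigroup through \<open>\<rho>\<close> has at time \<open>1/p\<close> the moments
  \<open>s\<^sub>n\<^sup>1\<^sup>/\<^sup>p\<close>, so it agrees with \<open>(\<rho>\<^sub>c)\<close> at all positive rational times and, by weak continuity, at
  all times.
\<close>

section \<open>Mellin transforms and the product convolution\<close>

lemma borel_measure_on_iff_AE:
  assumes "I \<in> sets borel"
  shows "borel_measure_on I \<mu> \<longleftrightarrow> sets \<mu> = sets borel \<and> (AE x in \<mu>. x \<in> I)"
proof -
  have "emeasure \<mu> (- I) = 0 \<longleftrightarrow> (AE x in \<mu>. x \<in> I)" if s: "sets \<mu> = sets borel"
  proof -
    have I: "- I \<in> sets \<mu>" using assms by (simp add: s borel_comp)
    then have "- I \<in> null_sets \<mu> \<longleftrightarrow> (AE x in \<mu>. x \<notin> - I)" by (rule AE_iff_null_sets)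
    with I show ?thesis by (auto simp: null_sets_def)
  qed
  then show ?thesis unfolding borel_measure_on_def by auto
qed

lemma prob_on_pos_iff:
  "prob_on {0<..} \<mu> \<longleftrightarrow> prob_space \<mu> \<and> sets \<mu> = sets borel \<and> (AE x in \<mu>. 0 < x)"
  by (auto simp: prob_on_def borel_measure_on_iff_AE)

lemma complex_powr_of_pos_real:
  assumes "0 < t"
  shows "complex_of_real t powr z = exp (z * of_real (ln t))"
  using assms by (simp add: powr_def Ln_of_real)

text \<open>The principal branch is given by a separate formula on each side of 0, so measurability
  reduces to that of the real logarithm.\<close>

lemma borel_measurable_of_real_powr [measurable]:
  "(\<lambda>t. complex_of_real t powr z) \<in> borel_measurable borel"
proof -
  have eq: "complex_of_real t powr z = (if t = 0 then 0 else if 0 < t then exp (z * of_real (ln t))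
      else exp (z * (of_real (ln (- t)) + \<i> * of_real pi)))" for t :: real
  proof (cases "t < 0")
    case True
    have "Ln (complex_of_real t) = of_real (ln (- t)) + \<i> * of_real pi"
      using Ln_minus[of "complex_of_real (- t)"] Ln_of_real[of "- t"] True by simp
    then show ?thesis using True by (simp add: powr_def)
  qed (auto simp: complex_powr_of_pos_real)
  show ?thesis unfolding eq by measurable
qed

lemma prob_on_return: "r > 0 \<Longrightarrow> prob_on {0<..} (return borel r)"
  by (auto simp: prob_on_pos_iff prob_space_return AE_return)

lemma AE_pair_pos:
  assumes "prob_on {0<..} \<mu>" "prob_on {0<..} \<nu>"
  shows "AE p in \<mu> \<Otimes>\<^sub>M \<nu>. 0 < fst p \<and> 0 < snd p"
proof -
  interpret M: prob_space \<mu> using assms by (simp add: prob_on_pos_iff)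
  interpret N: prob_space \<nu> using assms by (simp add: prob_on_pos_iff)
  have [measurable_cong]: "sets \<mu> = sets borel" "sets \<nu> = sets borel"
    using assms by (auto simp: prob_on_pos_iff)
  interpret P: pair_prob_space \<mu> \<nu> ..
  have A: "AE x in \<mu>. 0 < x" and B: "AE x in \<nu>. 0 < x"
    using assms by (auto simp: prob_on_pos_iff)
  show ?thesis
  proof (rule P.AE_pair_measure)
    show "AE x in \<mu>. AE y in \<nu>. 0 < fst (x, y) \<and> 0 < snd (x, y)"
      using A
    proof eventually_elim
      case (elim x)
      with B show ?case by simp
    qed
  qed measurable
qed

lemma prob_on_prod_convolution:
  assumes "prob_on {0<..} \<mu>" "prob_on {0<..} \<nu>"
  shows "prob_on {0<..} (prod_convolution \<mu> \<nu>)"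
proof -
  interpret M: prob_space \<mu> using assms by (simp add: prob_on_pos_iff)
  interpret N: prob_space \<nu> using assms by (simp add: prob_on_pos_iff)
  have [measurable_cong]: "sets \<mu> = sets borel" "sets \<nu> = sets borel"
    using assms by (auto simp: prob_on_pos_iff)
  interpret P: pair_prob_space \<mu> \<nu> ..
  show ?thesis
    unfolding prob_on_pos_iff prod_convolution_def
  proof (intro conjI)
    show "prob_space (distr (\<mu> \<Otimes>\<^sub>M \<nu>) borel (\<lambda>(s, t). s * t))"
      by (rule P.prob_space_distr) measurable
    show "AE x in distr (\<mu> \<Otimes>\<^sub>M \<nu>) borel (\<lambda>(s, t). s * t). 0 < x"
    proof (subst AE_distr_iff)
      show "AE p in \<mu> \<Otimes>\<^sub>M \<nu>. 0 < (case p of (s, t) \<Rightarrow> s * t)"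
        using AE_pair_pos[OF assms] by eventually_elim (simp add: case_prod_beta)
    qed auto
  qed simp
qed

lemma prob_on_prod_convolution_power:
  "prob_on {0<..} \<tau> \<Longrightarrow> prob_on {0<..} (prod_convolution_power \<tau> n)"
  by (induction n) (auto intro: prob_on_prod_convolution prob_on_return)

text \<open>Stated for nonnegative integrals, so that it applies to convolution roots whose moments are not
  yet known to be finite.\<close>

lemma nn_moment_prod_convolution:
  assumes "prob_on {0<..} \<mu>" "prob_on {0<..} \<nu>"
  shows "(\<integral>\<^sup>+x. ennreal (x ^ n) \<partial>prod_convolution \<mu> \<nu>)
    = (\<integral>\<^sup>+x. ennreal (x ^ n) \<partial>\<mu>) * (\<integral>\<^sup>+x. ennreal (x ^ n) \<partial>\<nu>)"
proof -
  interpret M: prob_space \<mu> using assms by (simp add: prob_on_pos_iff)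
  interpret N: prob_space \<nu> using assms by (simp add: prob_on_pos_iff)
  have [measurable_cong]: "sets \<mu> = sets borel" "sets \<nu> = sets borel"
    using assms by (auto simp: prob_on_pos_iff)
  interpret P: pair_prob_space \<mu> \<nu> ..
  have "(\<integral>\<^sup>+x. ennreal (x ^ n) \<partial>prod_convolution \<mu> \<nu>)
      = (\<integral>\<^sup>+p. ennreal ((fst p * snd p) ^ n) \<partial>(\<mu> \<Otimes>\<^sub>M \<nu>))"
    unfolding prod_convolution_def by (subst nn_integral_distr) (auto simp: case_prod_beta)
  also have "\<dots> = (\<integral>\<^sup>+p. ennreal (fst p ^ n) * ennreal (snd p ^ n) \<partial>(\<mu> \<Otimes>\<^sub>M \<nu>))"
    using AE_pair_pos[OF assms]
    by (intro nn_integral_cong_AE, eventually_elim) (simp add: power_mult_distrib ennreal_mult)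
  also have "\<dots> = (\<integral>\<^sup>+x. \<integral>\<^sup>+y. ennreal (x ^ n) * ennreal (y ^ n) \<partial>\<nu> \<partial>\<mu>)"
    by (subst N.nn_integral_fst[symmetric]) auto
  also have "\<dots> = (\<integral>\<^sup>+x. ennreal (x ^ n) \<partial>\<mu>) * (\<integral>\<^sup>+x. ennreal (x ^ n) \<partial>\<nu>)"
    by (simp add: nn_integral_cmult nn_integral_multc)
  finally show ?thesis .
qed

lemma nn_moment_prod_convolution_power:
  assumes "prob_on {0<..} \<tau>"
  shows "(\<integral>\<^sup>+x. ennreal (x ^ n) \<partial>prod_convolution_power \<tau> p) = (\<integral>\<^sup>+x. ennreal (x ^ n) \<partial>\<tau>) ^ p"
proof (induction p)
  case (Suc p)
  show ?case
    using nn_moment_prod_convolution[OF assms prob_on_prod_convolution_power[OF assms]] Suc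
    by simp
qed (simp add: nn_integral_return)

text \<open>The transform is prescribed only on the closed half plane \<open>Re z \<ge> 0\<close>, where every power
  moment of the measures considered here is finite.\<close>

definition has_mellin :: "real measure \<Rightarrow> (complex \<Rightarrow> complex) \<Rightarrow> bool" where
  "has_mellin \<mu> \<phi> \<longleftrightarrow> prob_on {0<..} \<mu> \<and>
    (\<forall>z. Re z \<ge> 0 \<longrightarrow> has_bochner_integral \<mu> (\<lambda>t. complex_of_real t powr z) (\<phi> z))"

text \<open>The substitution \<open>t = e\<^sup>y\<close> turns the transform on the imaginary axis into a characteristic
  function, which gives access to the theorems of Levy.\<close>

lemma char_distr_ln:
  assumes "has_mellin \<mu> \<phi>"
  shows "char (distr \<mu> borel ln) t = \<phi> (\<i> * of_real t)"
proof -
  have [measurable_cong]: "sets \<mu> = sets borel"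
    using assms by (auto simp: prob_on_pos_iff has_mellin_def)
  have "has_bochner_integral \<mu> (\<lambda>x. complex_of_real x powr (\<i> * of_real t)) (\<phi> (\<i> * of_real t))"
    using assms by (auto simp: has_mellin_def)
  moreover have "(LINT x|\<mu>. iexp (t * ln x)) = (LINT x|\<mu>. complex_of_real x powr (\<i> * of_real t))"
    by (rule integral_cong_AE)
       (use assms in \<open>auto elim!: eventually_mono simp: has_mellin_def prob_on_pos_iff
         complex_powr_of_pos_real mult_ac\<close>)
  ultimately show ?thesis
    unfolding char_def by (subst integral_distr) (auto simp: has_bochner_integral_iff)
qed

lemma distr_exp_distr_ln:
  assumes "prob_on {0<..} \<mu>"
  shows "distr (distr \<mu> borel ln) borel exp = \<mu>"
proof -
  have s [measurable_cong]: "sets \<mu> = sets borel"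
    using assms by (auto simp: prob_on_pos_iff)
  have "distr (distr \<mu> borel ln) borel exp = distr \<mu> borel (exp \<circ> ln)"
    by (rule distr_distr) auto
  also have "\<dots> = distr \<mu> borel (\<lambda>x. x)"
    by (rule distr_cong_AE) (use assms in \<open>auto elim!: eventually_mono simp: prob_on_pos_iff\<close>)
  also have "\<dots> = \<mu>" by (metis distr_id2 s)
  finally show ?thesis .
qed

lemma real_distribution_distr_ln:
  assumes "prob_on {0<..} \<mu>"
  shows "real_distribution (distr \<mu> borel ln)"
proof -
  interpret prob_space \<mu> using assms by (simp add: prob_on_pos_iff)
  have [measurable_cong]: "sets \<mu> = sets borel" using assms by (simp add: prob_on_pos_iff)
  show ?thesis by (intro real_distribution_distr) measurable
qed

lemma has_mellin_unique:
  assumes "has_mellin \<mu> \<phi>" "has_mellin \<nu> \<phi>"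
  shows "\<mu> = \<nu>"
proof -
  have p: "prob_on {0<..} \<mu>" "prob_on {0<..} \<nu>" using assms by (auto simp: has_mellin_def)
  have "distr \<mu> borel ln = distr \<nu> borel ln"
    by (intro Levy_uniqueness real_distribution_distr_ln p ext)
       (simp add: char_distr_ln[OF assms(1)] char_distr_ln[OF assms(2)])
  then show ?thesis
    using distr_exp_distr_ln[OF p(1)] distr_exp_distr_ln[OF p(2)] by metis
qed

lemma has_mellin_cong:
  "has_mellin \<mu> \<phi> \<Longrightarrow> (\<And>z. Re z \<ge> 0 \<Longrightarrow> \<phi> z = \<xi> z) \<Longrightarrow> has_mellin \<mu> \<xi>"
  by (auto simp: has_mellin_def)

lemma has_mellin_return:
  "r > 0 \<Longrightarrow> has_mellin (return borel r) (\<lambda>z. complex_of_real r powr z)"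
proof -
  assume r: "r > 0"
  have "integrable (return borel r) (\<lambda>t. complex_of_real t powr z)" for z
    by (rule integrableI_bounded) (auto simp: nn_integral_return)
  with r show ?thesis
    by (auto simp: has_mellin_def prob_on_return has_bochner_integral_iff integral_return)
qed

lemma has_mellin_prod_convolution:
  assumes "has_mellin \<mu> \<phi>" "has_mellin \<nu> \<xi>"
  shows "has_mellin (prod_convolution \<mu> \<nu>) (\<lambda>z. \<phi> z * \<xi> z)"
proof -
  have p: "prob_on {0<..} \<mu>" "prob_on {0<..} \<nu>" using assms by (auto simp: has_mellin_def)
  interpret M: prob_space \<mu> using p by (simp add: prob_on_pos_iff)
  interpret N: prob_space \<nu> using p by (simp add: prob_on_pos_iff)
  have [measurable_cong]: "sets \<mu> = sets borel" "sets \<nu> = sets borel"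
    using p by (auto simp: prob_on_pos_iff)
  interpret P: pair_prob_space \<mu> \<nu> ..
  have "has_bochner_integral (prod_convolution \<mu> \<nu>) (\<lambda>t. complex_of_real t powr z) (\<phi> z * \<xi> z)"
    if z: "Re z \<ge> 0" for z
  proof -
    let ?g = "\<lambda>t. complex_of_real t powr z"
    have a: "integrable \<mu> ?g" "integral\<^sup>L \<mu> ?g = \<phi> z" "integrable \<nu> ?g" "integral\<^sup>L \<nu> ?g = \<xi> z"
      using assms z by (auto simp: has_mellin_def has_bochner_integral_iff)
    have int: "integrable (\<mu> \<Otimes>\<^sub>M \<nu>) (\<lambda>p. ?g (fst p) * ?g (snd p))"
    proof (rule P.Fubini_integrable)
      show "integrable \<mu> (\<lambda>x. LINT y|\<nu>. norm (?g (fst (x, y)) * ?g (snd (x, y))))"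
        using a by (simp add: norm_mult)
      show "AE x in \<mu>. integrable \<nu> (\<lambda>y. ?g (fst (x, y)) * ?g (snd (x, y)))"
        using a by simp
    qed measurable
    have "(\<integral>p. ?g (fst p) * ?g (snd p) \<partial>(\<mu> \<Otimes>\<^sub>M \<nu>)) = \<phi> z * \<xi> z"
      using P.integral_fst'[OF int] a by simp
    then have "has_bochner_integral (\<mu> \<Otimes>\<^sub>M \<nu>) (\<lambda>p. ?g (fst p) * ?g (snd p)) (\<phi> z * \<xi> z)"
      using int by (simp add: has_bochner_integral_iff)
    moreover have "AE p in \<mu> \<Otimes>\<^sub>M \<nu>. ?g (fst p) * ?g (snd p) = ?g (case p of (s, t) \<Rightarrow> s * t)"
      using AE_pair_pos[OF p]
      by eventually_elim (simp add: case_prod_beta powr_times_real)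
    ultimately have "has_bochner_integral (\<mu> \<Otimes>\<^sub>M \<nu>) (\<lambda>p. ?g (case p of (s, t) \<Rightarrow> s * t)) (\<phi> z * \<xi> z)"
      by (subst (asm) has_bochner_integral_cong_AE) auto
    then show ?thesis
      unfolding prod_convolution_def by (intro has_bochner_integral_distr) auto
  qed
  then show ?thesis
    using prob_on_prod_convolution[OF p] by (auto simp: has_mellin_def)
qed

lemma has_mellin_prod_convolution_power:
  assumes "has_mellin \<tau> \<phi>"
  shows "has_mellin (prod_convolution_power \<tau> n) (\<lambda>z. \<phi> z ^ n)"
proof (induction n)
  case 0
  show ?case using has_mellin_return[of 1] by simp
next
  case (Suc n)
  then show ?case using has_mellin_prod_convolution[OF assms Suc] by simp
qed

lemma has_mellin_moments:
  assumes "has_mellin \<mu> \<phi>" and "\<And>n. n \<ge> 1 \<Longrightarrow> \<phi> (of_nat n) = of_real (s n)"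
  shows "has_moments \<mu> s"
  unfolding has_moments_def
proof (intro allI impI)
  fix n :: nat assume n: "1 \<le> n"
  have p: "prob_on {0<..} \<mu>" using assms by (auto simp: has_mellin_def)
  then have [measurable_cong]: "sets \<mu> = sets borel" by (simp add: prob_on_pos_iff)
  have "has_bochner_integral \<mu> (\<lambda>t. complex_of_real t powr of_nat n) (of_real (s n))"
    using assms n unfolding has_mellin_def by (metis Re_complex_of_real of_real_of_nat_eq of_nat_0_le_iff)
  then have "has_bochner_integral \<mu> (\<lambda>t. complex_of_real (t ^ n)) (of_real (s n))"
    by (rule has_bochner_integral_cong_AE[THEN iffD1, rotated -1])
       (use p n in \<open>auto elim!: eventually_mono simp: prob_on_pos_iff powr_nat'\<close>)
  from has_bochner_integral_Re[OF this] show "has_bochner_integral \<mu> (\<lambda>x. x ^ n) (s n)"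
    by (simp del: of_real_power)
qed

section \<open>Multiplicative compound Poisson laws\<close>

lemma norm_of_real_powr:
  "0 \<le> t \<Longrightarrow> norm (complex_of_real t powr z) = t powr Re z"
  by (cases "t = 0") (auto simp: norm_powr_real_powr)

lemma AE_le_1_prod_convolution:
  assumes "prob_on {0<..} \<mu>" "prob_on {0<..} \<nu>" "AE x in \<mu>. x \<le> 1" "AE x in \<nu>. x \<le> 1"
  shows "AE x in prod_convolution \<mu> \<nu>. x \<le> 1"
proof -
  interpret M: prob_space \<mu> using assms by (simp add: prob_on_pos_iff)
  interpret N: prob_space \<nu> using assms by (simp add: prob_on_pos_iff)
  have [measurable_cong]: "sets \<mu> = sets borel" "sets \<nu> = sets borel"
    using assms by (auto simp: prob_on_pos_iff)
  interpret P: pair_prob_space \<mu> \<nu> ..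
  have "AE p in \<mu> \<Otimes>\<^sub>M \<nu>. fst p \<le> 1 \<and> snd p \<le> 1"
  proof (rule P.AE_pair_measure)
    show "AE x in \<mu>. AE y in \<nu>. fst (x, y) \<le> 1 \<and> snd (x, y) \<le> 1"
      using assms(3)
    proof eventually_elim
      case (elim x)
      with assms(4) show ?case by simp
    qed
  qed measurable
  then have "AE p in \<mu> \<Otimes>\<^sub>M \<nu>. (case p of (s, t) \<Rightarrow> s * t) \<le> 1"
    using AE_pair_pos[OF assms(1,2)]
    by eventually_elim (simp add: case_prod_beta mult_le_one)
  then show ?thesis
    unfolding prod_convolution_def by (subst AE_distr_iff) auto
qed

text \<open>Let \<open>\<omega>\<close> be \<open>\<theta>\<close> normalised to a probability. The law of a product of \<open>N\<close> independent factors
  distributed as \<open>\<omega>\<close>, with \<open>N\<close> Poisson distributed with mean \<open>\<theta>(]0,1])\<close>, has as its Mellin transform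
  the Poisson generating function evaluated at that of \<open>\<omega>\<close>. A zero measure cannot be normalised and
  corresponds to the unit mass at 1.\<close>

lemma compound_poisson_mellin:
  assumes fin: "finite_measure \<theta>" and s: "sets \<theta> = sets borel"
    and ae: "AE w in \<theta>. 0 < w \<and> w \<le> 1"
  shows "\<exists>\<mu>. has_mellin \<mu> (\<lambda>z. exp (\<integral>w. (complex_of_real w powr z - 1) \<partial>\<theta>))"
proof (cases "measure \<theta> (space \<theta>) = 0")
  case True
  then have "emeasure \<theta> (space \<theta>) = 0"
    using fin by (simp add: finite_measure.emeasure_eq_measure)
  then have "AE w in \<theta>. False"
    by (intro AE_I[where N = "space \<theta>"]) auto
  then have "(\<integral>w. (complex_of_real w powr z - 1) \<partial>\<theta>) = 0" for z
    by (intro integral_eq_zero_AE) auto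
  then show ?thesis using has_mellin_return[of 1] by (intro exI[of _ "return borel 1"]) simp
next
  case False
  interpret T: finite_measure \<theta> by fact
  note [measurable_cong] = s
  define l where "l = measure \<theta> (space \<theta>)"
  have l: "l > 0" using False by (simp add: l_def less_le)
  define \<omega> where "\<omega> = density \<theta> (\<lambda>_. ennreal (1 / l))"
  have s\<omega> [measurable_cong]: "sets \<omega> = sets borel" by (simp add: \<omega>_def s)
  have ae\<omega>: "AE w in \<omega>. 0 < w \<and> w \<le> 1"
    unfolding \<omega>_def by (subst AE_density) (use ae in auto)
  have "emeasure \<omega> (space \<omega>) = ennreal (1 / l) * emeasure \<theta> (space \<theta>)"
    by (simp add: \<omega>_def emeasure_density_const)
  also have "\<dots> = 1"
    using l by (simp add: T.emeasure_eq_measure l_def[symmetric] ennreal_mult[symmetric])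
  finally have prob: "prob_space \<omega>" by (rule prob_spaceI)
  then have p\<omega>: "prob_on {0<..} \<omega>"
    using ae\<omega> s\<omega> by (auto simp: prob_on_pos_iff)
  have int\<theta>: "integrable \<theta> (\<lambda>w. complex_of_real w powr z)" if "Re z \<ge> 0" for z
  proof (rule T.integrable_const_bound[where B = 1])
    show "AE w in \<theta>. norm (complex_of_real w powr z) \<le> 1"
      using ae by eventually_elim (use that in \<open>simp add: norm_of_real_powr powr_le1\<close>)
  qed measurable
  define \<phi> where "\<phi> z = (\<integral>w. complex_of_real w powr z \<partial>\<theta>) / l" for z
  have m\<omega>: "has_mellin \<omega> \<phi>"
    unfolding has_mellin_def
  proof (intro conjI allI impI p\<omega>)
    fix z :: complex assume z: "Re z \<ge> 0"
    have "has_bochner_integral \<theta> (\<lambda>w. (1 / l) *\<^sub>R (complex_of_real w powr z)) (\<phi> z)"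
      using int\<theta>[OF z] by (simp add: \<phi>_def has_bochner_integral_iff scaleR_conv_of_real)
    then show "has_bochner_integral \<omega> (\<lambda>w. complex_of_real w powr z) (\<phi> z)"
      unfolding \<omega>_def using l by (intro has_bochner_integral_density) auto
  qed
  have ae_pow: "AE w in prod_convolution_power \<omega> k. 0 < w \<and> w \<le> 1" for k
  proof -
    have "AE w in prod_convolution_power \<omega> k. w \<le> 1"
    proof (induction k)
      case 0
      show ?case unfolding prod_convolution_power.simps by (subst AE_return) auto
    next
      case (Suc k)
      show ?case
        unfolding prod_convolution_power.simps
        by (rule AE_le_1_prod_convolution[OF p\<omega> prob_on_prod_convolution_power[OF p\<omega>] _ Suc])
           (use ae\<omega> in simp)
    qed
    then show ?thesis
      using prob_on_prod_convolution_power[OF p\<omega>, of k] by (simp add: prob_on_pos_iff)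
  qed
  define P where "P = poisson_pmf l"
  define \<mu> where "\<mu> = measure_pmf P \<bind> prod_convolution_power \<omega>"
  have pw: "prob_space (prod_convolution_power \<omega> k)" "sets (prod_convolution_power \<omega> k) = sets borel" for k
    using prob_on_prod_convolution_power[OF p\<omega>, of k] by (auto simp: prob_on_pos_iff)
  have meas [measurable]: "prod_convolution_power \<omega> \<in> measurable (measure_pmf P) (subprob_algebra borel)"
    using pw by (auto simp: space_subprob_algebra intro!: prob_space_imp_subprob_space)
  have s\<mu> [measurable_cong]: "sets \<mu> = sets borel"
    unfolding \<mu>_def by (rule sets_bind) (auto simp: pw)
  have ae\<mu>: "AE w in \<mu>. 0 < w \<and> w \<le> 1"
    unfolding \<mu>_def by (subst AE_bind[OF meas]) (use ae_pow in auto)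
  have "prob_space \<mu>"
    unfolding \<mu>_def
    by (rule measure_pmf.prob_space_bind[OF _ meas]) (use pw in auto)
  then have p\<mu>: "prob_on {0<..} \<mu>" using s\<mu> ae\<mu> by (auto simp: prob_on_pos_iff)
  interpret MU: prob_space \<mu> by fact
  have "has_mellin \<mu> (\<lambda>z. exp (\<integral>w. (complex_of_real w powr z - 1) \<partial>\<theta>))"
    unfolding has_mellin_def
  proof (intro conjI allI impI p\<mu>)
    fix z :: complex assume z: "Re z \<ge> 0"
    (* Clipping to [0,1] changes nothing almost everywhere and makes the power bounded on the whole
       line, as integration against a mixture of laws requires. *)
    define g where "g w = complex_of_real (max 0 (min 1 w)) powr z" for w
    have g_meas [measurable]: "g \<in> borel_measurable borel" unfolding g_def by measurable
    have g1: "norm (g w) \<le> 1" for w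
      using z by (auto simp: g_def norm_of_real_powr intro!: powr_le1)
    have Re1: "\<bar>Re (g w)\<bar> \<le> 1" and Im1: "\<bar>Im (g w)\<bar> \<le> 1" for w
      using abs_Re_le_cmod[of "g w"] abs_Im_le_cmod[of "g w"] g1[of w] by linarith+
    have pow: "integrable (prod_convolution_power \<omega> k) g" "integral\<^sup>L (prod_convolution_power \<omega> k) g = \<phi> z ^ k" for k
    proof -
      have "has_bochner_integral (prod_convolution_power \<omega> k) (\<lambda>t. complex_of_real t powr z) (\<phi> z ^ k)"
        using has_mellin_prod_convolution_power[OF m\<omega>, of k] z by (auto simp: has_mellin_def)
      also have "?this \<longleftrightarrow> has_bochner_integral (prod_convolution_power \<omega> k) g (\<phi> z ^ k)"
      proof (rule has_bochner_integral_cong_AE)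
        show "AE t in prod_convolution_power \<omega> k. complex_of_real t powr z = g t"
          using ae_pow[of k] by eventually_elim (auto simp: g_def)
      qed (auto simp: measurable_cong_sets[OF pw(2) refl])
      finally show "integrable (prod_convolution_power \<omega> k) g" "integral\<^sup>L (prod_convolution_power \<omega> k) g = \<phi> z ^ k"
        by (auto simp: has_bochner_integral_iff)
    qed
    have \<phi>1: "norm (\<phi> z) \<le> 1"
    proof -
      have "norm (integral\<^sup>L N g) \<le> 1" if "prob_space N" "integrable N g" for N
      proof -
        interpret N: prob_space N by fact
        have "norm (integral\<^sup>L N g) \<le> (\<integral>w. 1 \<partial>N)"
          by (rule Bochner_Integration.integral_norm_bound_integral[OF that(2) _ g1]) simp
        then show ?thesis by (simp add: N.prob_space)
      qed
      from this[OF pw(1) pow(1), of 1] show ?thesis using pow(2)[of 1] by simp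
    qed
    have pois: "integral\<^sup>L (measure_pmf P) (\<lambda>k. \<phi> z ^ k) = exp (of_real l * (\<phi> z - 1))"
      and pois_int: "integrable (measure_pmf P) (\<lambda>k. \<phi> z ^ k)"
    proof -
      have nP: "norm (\<phi> z ^ k) \<le> 1" for k using \<phi>1 by (simp add: norm_power power_le_one)
      show int: "integrable (measure_pmf P) (\<lambda>k. \<phi> z ^ k)"
        by (rule measure_pmf.integrable_const_bound[where B = 1]) (use nP in auto)
      have "integrable (count_space UNIV) (\<lambda>k. pmf P k *\<^sub>R \<phi> z ^ k)"
        using int unfolding measure_pmf_eq_density by (subst (asm) integrable_density) auto
      then have "(\<lambda>k. pmf P k *\<^sub>R \<phi> z ^ k) sums (\<integral>k. pmf P k *\<^sub>R \<phi> z ^ k \<partial>count_space UNIV)"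
        by (rule sums_integral_count_space_nat)
      also have "(\<integral>k. pmf P k *\<^sub>R \<phi> z ^ k \<partial>count_space UNIV) = integral\<^sup>L (measure_pmf P) (\<lambda>k. \<phi> z ^ k)"
        unfolding measure_pmf_eq_density by (subst integral_density) auto
      finally have 1: "(\<lambda>k. pmf P k *\<^sub>R \<phi> z ^ k) sums integral\<^sup>L (measure_pmf P) (\<lambda>k. \<phi> z ^ k)" .
      have "(\<lambda>k. exp (- of_real l) * ((of_real l * \<phi> z) ^ k /\<^sub>R fact k)) sums (exp (- of_real l) * exp (of_real l * \<phi> z))"
        by (intro sums_mult exp_converges)
      also have "(\<lambda>k. exp (- of_real l) * ((of_real l * \<phi> z) ^ k /\<^sub>R fact k)) = (\<lambda>k. pmf P k *\<^sub>R \<phi> z ^ k)"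
        using l by (auto simp: P_def scaleR_conv_of_real power_mult_distrib field_simps exp_of_real[symmetric])
      also have "exp (- of_real l) * exp (of_real l * \<phi> z) = exp (of_real l * (\<phi> z - 1))"
        by (simp add: algebra_simps flip: exp_add)
      finally show "integral\<^sup>L (measure_pmf P) (\<lambda>k. \<phi> z ^ k) = exp (of_real l * (\<phi> z - 1))"
        using 1 sums_unique2 by blast
    qed
    have g_int: "integrable \<mu> g"
      by (rule MU.integrable_const_bound[where B = 1]) (use g1 in auto)
    have bd: "AE k in measure_pmf P. emeasure (prod_convolution_power \<omega> k) (space (prod_convolution_power \<omega> k)) \<le> ennreal 1"
      using pw(1) by (auto simp: prob_space.emeasure_space_1)
    have bind: "integral\<^sup>L \<mu> u = (\<integral>k. integral\<^sup>L (prod_convolution_power \<omega> k) u \<partial>measure_pmf P)"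
      if "u \<in> borel_measurable borel" "\<And>x. \<bar>u x\<bar> \<le> 1" for u :: "real \<Rightarrow> real"
      unfolding \<mu>_def
      by (rule integral_bind[OF that(1) that(2) meas measure_pmf.finite_measure_axioms bd])
    have "integral\<^sup>L \<mu> (\<lambda>w. Re (g w)) = (\<integral>k. Re (\<phi> z ^ k) \<partial>measure_pmf P)"
      by (subst bind) (use Re1 in \<open>simp_all only: integral_Re[OF pow(1)] pow(2), measurable\<close>)
    moreover have "integral\<^sup>L \<mu> (\<lambda>w. Im (g w)) = (\<integral>k. Im (\<phi> z ^ k) \<partial>measure_pmf P)"
      by (subst bind) (use Im1 in \<open>simp_all only: integral_Im[OF pow(1)] pow(2), measurable\<close>)
    ultimately have "integral\<^sup>L \<mu> g = integral\<^sup>L (measure_pmf P) (\<lambda>k. \<phi> z ^ k)"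
      using g_int pois_int by (simp add: complex_eq_iff integral_Re integral_Im)
    also have "\<dots> = exp (of_real l * (\<phi> z - 1))" by (rule pois)
    also have "of_real l * (\<phi> z - 1) = (\<integral>w. (complex_of_real w powr z - 1) \<partial>\<theta>)"
    proof -
      have "(\<integral>w. (complex_of_real w powr z - 1) \<partial>\<theta>)
          = (\<integral>w. complex_of_real w powr z \<partial>\<theta>) - (\<integral>w. 1 \<partial>\<theta>)"
        by (rule Bochner_Integration.integral_diff[OF int\<theta>[OF z]]) simp
      also have "(\<integral>w. 1 \<partial>\<theta>) = complex_of_real l" by (simp add: l_def scaleR_conv_of_real)
      finally show ?thesis using l by (simp add: \<phi>_def right_diff_distrib)
    qed
    finally have "has_bochner_integral \<mu> g (exp (\<integral>w. (complex_of_real w powr z - 1) \<partial>\<theta>))"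
      using g_int by (simp add: has_bochner_integral_iff)
    also have "?this \<longleftrightarrow> has_bochner_integral \<mu> (\<lambda>t. complex_of_real t powr z) (exp (\<integral>w. (complex_of_real w powr z - 1) \<partial>\<theta>))"
    proof (rule has_bochner_integral_cong_AE)
      show "AE t in \<mu>. g t = complex_of_real t powr z"
        using ae\<mu> by eventually_elim (auto simp: g_def)
    qed auto
    finally show "has_bochner_integral \<mu> (\<lambda>t. complex_of_real t powr z) (exp (\<integral>w. (complex_of_real w powr z - 1) \<partial>\<theta>))" .
  qed
  then show ?thesis by blast
qed

section \<open>Weak convergence under bounded second moments\<close>

text \<open>The radial retraction onto the ball of radius \<open>R\<close>. Composing with it makes a continuous function
  bounded and keeps it continuous, at a cost that is quadratic in its size.\<close>

definition soft_cut :: "real \<Rightarrow> 'a::real_normed_vector \<Rightarrow> 'a" where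
  "soft_cut R y = (1 / max 1 (norm y / R)) *\<^sub>R y"

lemma norm_soft_cut:
  assumes "R > 0" shows "norm (soft_cut R y) \<le> R"
  using assms by (auto simp: soft_cut_def max_def field_simps)

lemma norm_diff_soft_cut:
  assumes "R > 0" shows "norm (y - soft_cut R y) \<le> (norm y)\<^sup>2 / R"
proof (cases "norm y \<le> R")
  case True
  then have "max 1 (norm y / R) = 1" using assms by (simp add: max_def)
  then show ?thesis using assms by (simp add: soft_cut_def)
next
  case False
  then have m: "max 1 (norm y / R) = norm y / R" using assms by (simp add: max_def field_simps)
  have y: "norm y > 0" using False assms by linarith
  have "y - soft_cut R y = (1 - R / norm y) *\<^sub>R y"
    by (simp add: soft_cut_def m algebra_simps)
  then have "norm (y - soft_cut R y) = \<bar>1 - R / norm y\<bar> * norm y" by simp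
  also have "\<dots> \<le> 1 * norm y"
    using False assms y by (intro mult_right_mono) (auto simp: field_simps abs_le_iff)
  also have "\<dots> \<le> (norm y)\<^sup>2 / R"
    using False assms y by (simp add: field_simps power2_eq_square)
  finally show ?thesis .
qed

lemma isCont_soft_cut:
  assumes "R > 0" "isCont h x" shows "isCont (\<lambda>x. soft_cut R (h x)) x"
  unfolding soft_cut_def using assms by (intro continuous_intros) auto

text \<open>Weak convergence controls only bounded continuous integrands. For an unbounded \<open>h\<close>, replace \<open>h\<close> by
  its truncation at level \<open>R\<close>: by the second moments this changes every integral by at most
  \<open>B / R\<close>, uniformly along the sequence. The limit measure inherits the bound \<open>B\<close> by truncating
  \<open>|h|\<^sup>2\<close> and using monotone convergence.\<close>

lemma weak_conv_integral_bounded_second_moment: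
  fixes h :: "real \<Rightarrow> complex"
  assumes rd: "\<And>n. real_distribution (\<mu> n)" and rM: "real_distribution M"
    and wc: "weak_conv_m \<mu> M" and cont: "\<And>x. isCont h x"
    and int: "\<And>n. integrable (\<mu> n) (\<lambda>x. (norm (h x))\<^sup>2)"
    and bd: "\<And>n. (\<integral>x. (norm (h x))\<^sup>2 \<partial>\<mu> n) \<le> B"
  shows "integrable M h" "(\<lambda>n. integral\<^sup>L (\<mu> n) h) \<longlonglongrightarrow> integral\<^sup>L M h"
proof -
  interpret Mn: real_distribution "\<mu> n" for n by fact
  interpret M: real_distribution M by fact
  have [measurable]: "h \<in> borel_measurable borel"
    using cont by (intro borel_measurable_continuous_onI continuous_at_imp_continuous_on) auto
  have le1: "norm y \<le> 1 + (norm y)\<^sup>2" for y :: complex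
  proof -
    have "2 * norm y \<le> 1 + (norm y)\<^sup>2" using sum_squares_bound[of "1::real" "norm y"] by simp
    moreover have "0 \<le> norm y" by simp
    ultimately show ?thesis by linarith
  qed
  have fin: "(\<integral>\<^sup>+x. ennreal ((norm (h x))\<^sup>2) \<partial>M) \<le> ennreal B"
  proof -
    have "(\<lambda>k. \<integral>\<^sup>+x. ennreal (min ((norm (h x))\<^sup>2) (real k)) \<partial>M) \<longlonglongrightarrow> (\<integral>\<^sup>+x. ennreal ((norm (h x))\<^sup>2) \<partial>M)"
    proof (rule nn_integral_LIMSEQ)
      show "incseq (\<lambda>k x. ennreal (min ((norm (h x))\<^sup>2) (real k)))"
        by (auto simp: incseq_def le_fun_def intro!: ennreal_leI)
      fix x
      obtain N where N: "(norm (h x))\<^sup>2 \<le> real N" using real_arch_simple by blast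
      have "\<forall>\<^sub>F k in sequentially. ennreal (min ((norm (h x))\<^sup>2) (real k)) = ennreal ((norm (h x))\<^sup>2)"
        using eventually_ge_at_top[of N]
        by eventually_elim (use N in \<open>auto simp: min_def\<close>)
      then show "(\<lambda>k. ennreal (min ((norm (h x))\<^sup>2) (real k))) \<longlonglongrightarrow> ennreal ((norm (h x))\<^sup>2)"
        by (rule tendsto_eventually)
    qed measurable
    moreover have "(\<integral>\<^sup>+x. ennreal (min ((norm (h x))\<^sup>2) (real k)) \<partial>M) \<le> ennreal B" for k
    proof -
      have "integrable M (\<lambda>x. min ((norm (h x))\<^sup>2) (real k))"
        by (rule M.integrable_const_bound[where B = "real k"]) auto
      then have "(\<integral>\<^sup>+x. ennreal (min ((norm (h x))\<^sup>2) (real k)) \<partial>M) = ennreal (\<integral>x. min ((norm (h x))\<^sup>2) (real k) \<partial>M)"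
        by (rule nn_integral_eq_integral) auto
      also have "(\<integral>x. min ((norm (h x))\<^sup>2) (real k) \<partial>M) \<le> B"
      proof (rule LIMSEQ_le_const2)
        show "(\<lambda>n. \<integral>x. min ((norm (h x))\<^sup>2) (real k) \<partial>\<mu> n) \<longlonglongrightarrow> (\<integral>x. min ((norm (h x))\<^sup>2) (real k) \<partial>M)"
          by (rule weak_conv_imp_integral_bdd_continuous_conv[OF rd rM wc, where B = "real k"])
             (auto intro!: continuous_intros cont)
        have "(\<integral>x. min ((norm (h x))\<^sup>2) (real k) \<partial>\<mu> n) \<le> B" for n
        proof -
          have "(\<integral>x. min ((norm (h x))\<^sup>2) (real k) \<partial>\<mu> n) \<le> (\<integral>x. (norm (h x))\<^sup>2 \<partial>\<mu> n)"
            by (intro integral_mono int Mn.integrable_const_bound[where B = "real k"]) auto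
          with bd[of n] show ?thesis by linarith
        qed
        then show "\<exists>N. \<forall>n\<ge>N. (\<integral>x. min ((norm (h x))\<^sup>2) (real k) \<partial>\<mu> n) \<le> B" by blast
      qed
      then have "ennreal (\<integral>x. min ((norm (h x))\<^sup>2) (real k) \<partial>M) \<le> ennreal B" by (rule ennreal_leI)
      finally show ?thesis .
    qed
    ultimately show ?thesis by (intro LIMSEQ_le_const2) auto
  qed
  have intM2: "integrable M (\<lambda>x. (norm (h x))\<^sup>2)"
    by (rule integrableI_bounded) (use fin in \<open>auto simp: less_top[symmetric] top_unique\<close>)
  have B0: "B \<ge> 0"
    using bd[of 0] by (smt (verit) integral_nonneg_AE AE_I2 zero_le_power2)
  have bdM: "(\<integral>x. (norm (h x))\<^sup>2 \<partial>M) \<le> B"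
    using fin B0 intM2 by (simp add: nn_integral_eq_integral)
  show intM: "integrable M h"
    by (rule Bochner_Integration.integrable_bound[where f = "\<lambda>x. 1 + (norm (h x))\<^sup>2"])
       (use intM2 le1 in auto)
  have intn: "integrable (\<mu> n) h" for n
    by (rule Bochner_Integration.integrable_bound[where f = "\<lambda>x. 1 + (norm (h x))\<^sup>2"])
       (use int le1 in auto)
  have cut: "norm (integral\<^sup>L N h - (\<integral>x. soft_cut R (h x) \<partial>N)) \<le> B / R"
    if N: "real_distribution N" "integrable N h" "integrable N (\<lambda>x. (norm (h x))\<^sup>2)"
      "(\<integral>x. (norm (h x))\<^sup>2 \<partial>N) \<le> B" and R: "R > 0" for N R
  proof -
    interpret N: real_distribution N by fact
    have m [measurable]: "(\<lambda>x. soft_cut R (h x)) \<in> borel_measurable borel"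
      using cont R
      by (intro borel_measurable_continuous_onI continuous_at_imp_continuous_on ballI isCont_soft_cut) auto
    have i: "integrable N (\<lambda>x. soft_cut R (h x))"
      by (rule N.integrable_const_bound[where B = R]) (use norm_soft_cut R in auto)
    have "norm (integral\<^sup>L N h - (\<integral>x. soft_cut R (h x) \<partial>N)) = norm (\<integral>x. h x - soft_cut R (h x) \<partial>N)"
      using N i by simp
    also have "\<dots> \<le> (\<integral>x. (norm (h x))\<^sup>2 / R \<partial>N)"
    proof (rule Bochner_Integration.integral_norm_bound_integral)
      show "norm (h x - soft_cut R (h x)) \<le> (norm (h x))\<^sup>2 / R" for x
        by (rule norm_diff_soft_cut[OF R])
    qed (use N i in auto)
    also have "\<dots> \<le> B / R" using N R by (simp add: divide_right_mono)
    finally show ?thesis .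
  qed
  show "(\<lambda>n. integral\<^sup>L (\<mu> n) h) \<longlonglongrightarrow> integral\<^sup>L M h"
  proof (rule LIMSEQ_I)
    fix e :: real assume e: "e > 0"
    (* Two truncation errors of at most B / R each, and a third share for the bounded integrands. *)
    define R where "R = 3 * (B + 1) / e"
    have R: "R > 0" using e B0 by (simp add: R_def)
    have BR: "B / R < e / 3" using e B0 by (simp add: R_def field_simps)
    have "(\<lambda>n. \<integral>x. soft_cut R (h x) \<partial>\<mu> n) \<longlonglongrightarrow> (\<integral>x. soft_cut R (h x) \<partial>M)"
      by (rule weak_conv_imp_integral_bdd_continuous_conv[OF rd rM wc, where B = R])
         (use R cont in \<open>auto intro!: isCont_soft_cut norm_soft_cut\<close>)
    from LIMSEQ_D[OF this, of "e / 3"] e obtain n0 where n0: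
      "\<And>n. n \<ge> n0 \<Longrightarrow> norm ((\<integral>x. soft_cut R (h x) \<partial>\<mu> n) - (\<integral>x. soft_cut R (h x) \<partial>M)) < e / 3"
      by auto
    show "\<exists>n0. \<forall>n\<ge>n0. norm (integral\<^sup>L (\<mu> n) h - integral\<^sup>L M h) < e"
    proof (intro exI allI impI)
      fix n assume n: "n \<ge> n0"
      let ?a = "integral\<^sup>L (\<mu> n) h" and ?b = "\<integral>x. soft_cut R (h x) \<partial>\<mu> n"
      let ?c = "\<integral>x. soft_cut R (h x) \<partial>M" and ?d = "integral\<^sup>L M h"
      have "norm (?a - ?b) < e / 3"
        using cut[OF rd intn int bd R, of n] BR by linarith
      moreover have "norm (?d - ?c) < e / 3"
        using cut[OF rM intM intM2 bdM R] BR by linarith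
      moreover have "norm (?b - ?c) < e / 3" using n0[OF n] .
      moreover have "norm (?a - ?d) \<le> norm (?a - ?b) + norm (?b - ?c) + norm (?d - ?c)"
        using norm_triangle_ineq[of "(?a - ?b) + (?b - ?c)" "?c - ?d"]
          norm_triangle_ineq[of "?a - ?b" "?b - ?c"] norm_minus_commute[of ?c ?d] by simp
      ultimately show "norm (?a - ?d) < e" by linarith
    qed
  qed
qed

section \<open>Existence of laws with a given Levy-Khintchine exponent\<close>

text \<open>For \<open>w = e\<^sup>-\<^sup>u\<close> the numerator is the integrand \<open>e\<^sup>-\<^sup>z\<^sup>u - 1 + z (1 - e\<^sup>-\<^sup>u)\<close> of a Levy-Khintchine exponent
  for downward jumps of size \<open>u\<close>. The division by \<open>(1 - w)\<^sup>2\<close> makes it bounded, and leaves a finite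
  measure to integrate against.\<close>

definition levy_kernel :: "complex \<Rightarrow> real \<Rightarrow> complex" where
  "levy_kernel z w = (of_real w powr z - 1 + z * (1 - of_real w)) / (1 - of_real w)\<^sup>2"

lemma levy_kernel_measurable [measurable]: "levy_kernel z \<in> borel_measurable borel"
  unfolding levy_kernel_def by measurable

lemma levy_kernel_1: "0 < w \<Longrightarrow> levy_kernel 1 w = 0"
  by (simp add: levy_kernel_def)

lemma levy_kernel_0: "0 < w \<Longrightarrow> levy_kernel 0 w = 0"
  by (simp add: levy_kernel_def)

text \<open>The second order Taylor estimate of \<open>w\<^sup>z\<close> at \<open>w = 1\<close>; the factor 4 bounds \<open>r\<^sup>-\<^sup>2\<close> on \<open>[1/2, 1]\<close>.\<close>

lemma norm_powr_minus_linear_le: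
  fixes z :: complex
  assumes w: "1 / 2 \<le> w" "w \<le> 1" and z: "0 \<le> Re z"
  shows "norm (of_real w powr z - (1 + z * (of_real w - 1))) \<le> 4 * norm z * (1 + norm z) * (1 - w)\<^sup>2"
proof -
  define S where "S = closed_segment (complex_of_real w) 1"
  (* F i is the i-th derivative of x powr z, written out to order 2. *)
  define F where "F i x = (if i = 0 then x powr z else if i = Suc 0 then z * x powr (z - 1)
    else z * ((z - 1) * x powr (z - 2)))" for i :: nat and x :: complex
  have F0: "F 0 = (\<lambda>x. x powr z)" and F1: "F (Suc 0) = (\<lambda>x. z * x powr (z - 1))"
    and F2: "F (Suc (Suc 0)) = (\<lambda>x. z * ((z - 1) * x powr (z - 2)))"
    by (simp_all add: F_def fun_eq_iff)
  have S: "\<exists>r. x = complex_of_real r \<and> 1 / 2 \<le> r \<and> r \<le> 1" if "x \<in> S" for x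
  proof -
    have "x \<in> complex_of_real ` closed_segment w 1"
      using that unfolding S_def closed_segment_of_real[symmetric] by simp
    then obtain r where "x = complex_of_real r" "r \<in> closed_segment w 1" by auto
    then show ?thesis using w by (auto simp: closed_segment_eq_real_ivl)
  qed
  have "norm (F 0 (of_real w) - (\<Sum>i\<le>1. F i 1 * (of_real w - 1) ^ i / fact i))
      \<le> (4 * norm z * (1 + norm z)) * norm (of_real w - 1 :: complex) ^ Suc 1 / fact 1"
  proof (rule field_Taylor[where S = S])
    show "convex S" by (simp add: S_def)
    show "(F i has_field_derivative F (Suc i) x) (at x within S)" if "x \<in> S" "i \<le> 1" for i x
    proof -
      obtain r where r: "x = complex_of_real r" "1 / 2 \<le> r" "r \<le> 1" using S[OF \<open>x \<in> S\<close>] by blast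
      have nx: "x \<notin> \<real>\<^sub>\<le>\<^sub>0" using r by (auto simp: complex_nonpos_Reals_iff)
      consider "i = 0" | "i = Suc 0" using \<open>i \<le> 1\<close> by linarith
      then show ?thesis
      proof cases
        case 1
        have "((\<lambda>x. x powr z) has_field_derivative z * x powr (z - 1)) (at x)"
          by (rule has_field_derivative_powr[OF nx])
        then show ?thesis unfolding 1 F0 F1 by (rule has_field_derivative_at_within)
      next
        case 2
        have "((\<lambda>x. x powr (z - 1)) has_field_derivative (z - 1) * x powr (z - 1 - 1)) (at x)"
          by (rule has_field_derivative_powr[OF nx])
        then have "((\<lambda>x. z * x powr (z - 1)) has_field_derivative z * ((z - 1) * x powr (z - 1 - 1))) (at x)"
          by (rule DERIV_cmult)
        moreover have "z - 1 - 1 = z - 2" by simp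
        ultimately show ?thesis unfolding 2 F1 F2
          by (auto intro: has_field_derivative_at_within)
      qed
    qed
    show "norm (F (Suc 1) x) \<le> 4 * norm z * (1 + norm z)" if "x \<in> S" for x
    proof -
      obtain r where r: "x = complex_of_real r" "1 / 2 \<le> r" "r \<le> 1" using S[OF \<open>x \<in> S\<close>] by blast
      have "norm (x powr (z - 2)) = r powr (Re z - 2)" using r by (simp add: norm_of_real_powr)
      also have "\<dots> = r powr Re z * (1 / r\<^sup>2)" using r by (simp add: powr_diff)
      also have "\<dots> \<le> 1 * 4"
      proof (rule mult_mono)
        show "r powr Re z \<le> 1" using r z by (intro powr_le1) auto
        have "(1 / 2)\<^sup>2 \<le> r\<^sup>2" using r by (intro power_mono) auto
        then show "1 / r\<^sup>2 \<le> 4" using r by (simp add: field_simps power2_eq_square)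
      qed (use r in auto)
      finally have a: "norm (x powr (z - 2)) \<le> 4" by simp
      have b: "norm (z - 1) \<le> 1 + norm z" using norm_triangle_ineq4[of z 1] by simp
      have "norm (F (Suc 1) x) = norm z * (norm (z - 1) * norm (x powr (z - 2)))"
        by (simp add: F_def norm_mult)
      also have "\<dots> \<le> norm z * ((1 + norm z) * 4)"
        by (intro mult_left_mono mult_mono a b) auto
      finally show ?thesis by (simp add: mult_ac)
    qed
  qed (auto simp: S_def)
  moreover have "norm (of_real w - 1 :: complex) = 1 - w"
    using w by (metis abs_minus_commute abs_of_nonneg diff_ge_0_iff_ge norm_of_real of_real_1 of_real_diff)
  ultimately show ?thesis by (simp add: F_def power2_eq_square)
qed

text \<open>Near \<open>w = 1\<close> Taylor's formula shows that the numerator is of order \<open>(1 - w)\<^sup>2\<close>; for \<open>w < 1/2\<close>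
  it is at most \<open>2 + |z|\<close> and the denominator is at least \<open>1/4\<close>. The bound is locally uniform
  in \<open>z\<close>, as dominated convergence in \<open>z\<close> requires.\<close>

lemma norm_levy_kernel_le:
  assumes w: "0 < w" "w < 1" and z: "0 \<le> Re z"
  shows "norm (levy_kernel z w) \<le> 8 * (1 + norm z)\<^sup>2"
proof -
  let ?N = "of_real w powr z - 1 + z * (1 - of_real w)"
  have n1: "norm ((1 - complex_of_real w)\<^sup>2) = (1 - w)\<^sup>2"
    by (metis norm_power norm_of_real of_real_1 of_real_diff power2_abs)
  have pos: "(1 - w)\<^sup>2 > 0" using w by simp
  have "norm ?N \<le> 8 * (1 + norm z)\<^sup>2 * (1 - w)\<^sup>2"
  proof (cases "1 / 2 \<le> w")
    case True
    have "norm ?N \<le> 4 * norm z * (1 + norm z) * (1 - w)\<^sup>2"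
      using norm_powr_minus_linear_le[of w z] True w z by (simp add: algebra_simps)
    also have "\<dots> \<le> 8 * (1 + norm z)\<^sup>2 * (1 - w)\<^sup>2"
    proof (rule mult_right_mono)
      have "4 * norm z * (1 + norm z) \<le> 8 * (1 + norm z) * (1 + norm z)"
        by (intro mult_right_mono) auto
      then show "4 * norm z * (1 + norm z) \<le> 8 * (1 + norm z)\<^sup>2"
        by (simp only: power2_eq_square mult.assoc)
    qed simp
    finally show ?thesis .
  next
    case False
    have "norm (of_real w powr z) \<le> 1"
      using w z by (simp add: norm_of_real_powr powr_le1)
    moreover have "norm (z * (1 - complex_of_real w)) \<le> norm z"
    proof -
      have "norm (1 - complex_of_real w) = 1 - w"
        using w by (metis abs_of_nonneg diff_ge_0_iff_ge less_eq_real_def norm_of_real of_real_1 of_real_diff)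
      then show ?thesis using w by (simp add: norm_mult mult_left_le)
    qed
    moreover have "norm ?N \<le> norm (of_real w powr z) + norm (1::complex) + norm (z * (1 - complex_of_real w))"
      using norm_triangle_ineq[of "of_real w powr z - 1" "z * (1 - complex_of_real w)"]
        norm_triangle_ineq4[of "of_real w powr z" 1] by linarith
    ultimately have "norm ?N \<le> 2 + norm z" by simp
    also have "\<dots> \<le> 2 * (1 + norm z)\<^sup>2"
      by (simp add: power2_eq_square algebra_simps)
    also have "\<dots> = 8 * (1 + norm z)\<^sup>2 * (1 / 2)\<^sup>2" by (simp add: power2_eq_square)
    also have "\<dots> \<le> 8 * (1 + norm z)\<^sup>2 * (1 - w)\<^sup>2"
      using False by (intro mult_left_mono power_mono) auto
    finally show ?thesis .
  qed
  then show ?thesis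
    using pos by (simp add: levy_kernel_def norm_divide n1 divide_le_eq)
qed

lemma continuous_at_of_real_max_powr:
  assumes "Re z > 0"
  shows "isCont (\<lambda>x. complex_of_real (max 0 x) powr z) x"
proof -
  have "continuous_on UNIV (\<lambda>x. complex_of_real (max 0 x) powr z)"
    by (rule continuous_on_powr_complex) (use assms in \<open>auto intro!: continuous_intros\<close>)
  then show ?thesis by (simp add: continuous_on_eq_continuous_at)
qed

text \<open>The drift \<open>L\<close> and the finite measure \<open>\<eta>\<close> of an exponent with jumps \<open>log w\<close>, \<open>0 < w < 1\<close>.\<close>

locale levy_data = finite_measure \<eta> for \<eta> :: "real measure" +
  fixes L :: real
  assumes sets_\<eta> [simp, measurable_cong]: "sets \<eta> = sets borel"
    and AE_\<eta>: "AE w in \<eta>. 0 < w \<and> w < 1"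
begin

lemma space_\<eta> [simp]: "space \<eta> = UNIV"
  using sets_eq_imp_space_eq[OF sets_\<eta>] by simp

definition exponent :: "complex \<Rightarrow> complex" where
  "exponent z = z * of_real L + (\<integral>w. levy_kernel z w \<partial>\<eta>)"

lemma integrable_levy_kernel:
  assumes "0 \<le> Re z" shows "integrable \<eta> (levy_kernel z)"
proof (rule integrable_const_bound[where B = "8 * (1 + norm z)\<^sup>2"])
  show "AE w in \<eta>. norm (levy_kernel z w) \<le> 8 * (1 + norm z)\<^sup>2"
    using AE_\<eta> by eventually_elim (simp add: norm_levy_kernel_le assms)
qed measurable

lemma exponent_tendsto:
  assumes z: "0 \<le> Re z"
  shows "(\<lambda>j. exponent (z + of_real (inverse (real (Suc j))))) \<longlonglongrightarrow> exponent z"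
proof -
  let ?z = "\<lambda>j. z + of_real (inverse (real (Suc j)))"
  have zlim: "?z \<longlonglongrightarrow> z"
    using tendsto_add[OF tendsto_const[of z] tendsto_of_real[OF LIMSEQ_inverse_real_of_nat]]
    by (simp only: of_real_0 add_0_right)
  have nz: "norm (?z j) \<le> 1 + norm z" for j
  proof -
    have "norm (?z j) \<le> norm z + norm (complex_of_real (inverse (real (Suc j))))"
      by (rule norm_triangle_ineq)
    also have "norm (complex_of_real (inverse (real (Suc j)))) = inverse (real (Suc j))"
      by (subst norm_of_real) simp
    also have "\<dots> \<le> 1" by (simp add: field_simps)
    finally show ?thesis by simp
  qed
  have "(\<lambda>j. \<integral>w. levy_kernel (?z j) w \<partial>\<eta>) \<longlonglongrightarrow> (\<integral>w. levy_kernel z w \<partial>\<eta>)"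
  proof (rule integral_dominated_convergence[where w = "\<lambda>_. 8 * (2 + norm z)\<^sup>2"])
    show "AE w in \<eta>. (\<lambda>j. levy_kernel (?z j) w) \<longlonglongrightarrow> levy_kernel z w"
      using AE_\<eta>
    proof eventually_elim
      case (elim w)
      then show ?case unfolding levy_kernel_def
        by (intro tendsto_intros zlim) auto
    qed
    show "AE w in \<eta>. norm (levy_kernel (?z j) w) \<le> 8 * (2 + norm z)\<^sup>2" for j
      using AE_\<eta>
    proof eventually_elim
      case (elim w)
      then have "norm (levy_kernel (?z j) w) \<le> 8 * (1 + norm (?z j))\<^sup>2"
        using z by (intro norm_levy_kernel_le) auto
      also have "\<dots> \<le> 8 * (2 + norm z)\<^sup>2"
        using nz[of j] by (intro mult_left_mono power_mono) auto
      finally show ?case .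
    qed
  qed auto
  then show ?thesis unfolding exponent_def by (intro tendsto_intros zlim)
qed

lemma exponent_0: "exponent 0 = 0"
proof -
  have "(\<integral>w. levy_kernel 0 w \<partial>\<eta>) = 0"
    by (rule integral_eq_zero_AE) (use AE_\<eta> in eventually_elim, simp add: levy_kernel_0)
  then show ?thesis by (simp add: exponent_def)
qed

text \<open>Removing the factors near 1 makes \<open>(1 - w)\<^sup>-\<^sup>2 d\<eta>\<close> finite. The compensator stays inside the
  kernel, so the drift does not depend on the cut.\<close>

definition cut_exponent :: "nat \<Rightarrow> complex \<Rightarrow> complex" where
  "cut_exponent m z = z * of_real L
    + (\<integral>w. indicator {..1 - 1 / real (Suc m)} w *\<^sub>R levy_kernel z w \<partial>\<eta>)"

lemma cut_exponent_1: "cut_exponent m 1 = of_real L"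
proof -
  have "(\<integral>w. indicator {..1 - 1 / real (Suc m)} w *\<^sub>R levy_kernel 1 w \<partial>\<eta>) = 0"
    by (rule integral_eq_zero_AE) (use AE_\<eta> in eventually_elim, simp add: levy_kernel_1)
  then show ?thesis by (simp add: cut_exponent_def)
qed

lemma norm_cut_kernel_le:
  assumes "0 \<le> Re z"
  shows "AE w in \<eta>. norm (indicator {..1 - 1 / real (Suc m)} w *\<^sub>R levy_kernel z w) \<le> 8 * (1 + norm z)\<^sup>2"
  using AE_\<eta>
  by eventually_elim (use assms in \<open>auto simp: norm_levy_kernel_le indicator_def\<close>)

lemma norm_cut_exponent_le:
  assumes z: "0 \<le> Re z"
  shows "norm (cut_exponent m z) \<le> norm z * \<bar>L\<bar> + 8 * (1 + norm z)\<^sup>2 * measure \<eta> (space \<eta>)"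
proof -
  have "norm (\<integral>w. indicator {..1 - 1 / real (Suc m)} w *\<^sub>R levy_kernel z w \<partial>\<eta>)
      \<le> (\<integral>w. 8 * (1 + norm z)\<^sup>2 \<partial>\<eta>)"
    by (intro order_trans[OF integral_norm_bound integral_mono_AE] norm_cut_kernel_le[OF z]
        integrable_norm integrable_mult_indicator integrable_levy_kernel[OF z]) auto
  also have "\<dots> = 8 * (1 + norm z)\<^sup>2 * measure \<eta> (space \<eta>)" by simp
  finally show ?thesis
    unfolding cut_exponent_def by (intro norm_triangle_mono) (auto simp: norm_mult)
qed

lemma cut_exponent_tendsto:
  assumes z: "0 \<le> Re z"
  shows "(\<lambda>m. cut_exponent m z) \<longlonglongrightarrow> exponent z"
proof -
  have "(\<lambda>m. \<integral>w. indicator {..1 - 1 / real (Suc m)} w *\<^sub>R levy_kernel z w \<partial>\<eta>)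
      \<longlonglongrightarrow> (\<integral>w. levy_kernel z w \<partial>\<eta>)"
  proof (rule integral_dominated_convergence[where w = "\<lambda>_. 8 * (1 + norm z)\<^sup>2"])
    show "AE w in \<eta>. (\<lambda>m. indicator {..1 - 1 / real (Suc m)} w *\<^sub>R levy_kernel z w) \<longlonglongrightarrow> levy_kernel z w"
      using AE_\<eta>
    proof eventually_elim
      case (elim w)
      then obtain N where N: "inverse (real (Suc N)) < 1 - w"
        using reals_Archimedean[of "1 - w"] by auto
      have "\<forall>\<^sub>F m in sequentially. indicator {..1 - 1 / real (Suc m)} w *\<^sub>R levy_kernel z w = levy_kernel z w"
        using eventually_ge_at_top[of N]
      proof eventually_elim
        case (elim m)
        have "inverse (real (Suc m)) \<le> inverse (real (Suc N))"
          using elim by (intro le_imp_inverse_le) auto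
        then have "w \<le> 1 - 1 / real (Suc m)" using N by (simp add: inverse_eq_divide)
        then show ?case by simp
      qed
      then show ?case by (rule tendsto_eventually)
    qed
  qed (use norm_cut_kernel_le[OF z] in auto)
  then show ?thesis unfolding cut_exponent_def exponent_def by (intro tendsto_intros)
qed

text \<open>The compensator \<open>\<integral> (1 - w) d\<theta>\<close> is finite after the cut, so it can be moved into the deterministic
  factor \<open>e\<^sup>c\<^sup>L\<^sup>+\<^sup>D\<close>; a compound Poisson law remains.\<close>

lemma exists_mellin_cut:
  assumes c: "0 < c"
  shows "\<exists>\<mu>. has_mellin \<mu> (\<lambda>z. exp (of_real c * cut_exponent m z))"
proof -
  define d where "d w = c * indicator {..1 - 1 / real (Suc m)} w / (1 - w)\<^sup>2" for w :: real
  have d_meas [measurable]: "d \<in> borel_measurable borel" unfolding d_def by measurable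
  have d0: "0 \<le> d w" for w using c by (simp add: d_def)
  have d_le: "d w \<le> c * (real (Suc m))\<^sup>2" for w
  proof (cases "w \<le> 1 - 1 / real (Suc m)")
    case True
    then have "1 / real (Suc m) \<le> 1 - w" by simp
    then have "(1 / real (Suc m))\<^sup>2 \<le> (1 - w)\<^sup>2" by (intro power_mono) auto
    then have "1 / (1 - w)\<^sup>2 \<le> 1 / (1 / real (Suc m))\<^sup>2" by (intro divide_left_mono) (auto intro!: mult_pos_pos simp: zero_less_power2 del: zero_less_power2)
    then have "c * (1 / (1 - w)\<^sup>2) \<le> c * (real (Suc m))\<^sup>2"
      using c by (intro mult_left_mono) (auto simp: power_divide)
    then show ?thesis using True by (simp add: d_def)
  qed (use c in \<open>simp add: d_def\<close>)
  define \<theta> where "\<theta> = density \<eta> (\<lambda>w. ennreal (d w))"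
  have s\<theta>: "sets \<theta> = sets borel" by (simp add: \<theta>_def)
  have d_int: "integrable \<eta> d"
    by (rule integrable_const_bound[where B = "c * (real (Suc m))\<^sup>2"]) (use d0 d_le in auto)
  have fin: "finite_measure \<theta>"
  proof (rule finite_measureI)
    have "emeasure \<theta> (space \<theta>) = (\<integral>\<^sup>+w. ennreal (d w) \<partial>\<eta>)"
      unfolding \<theta>_def by (subst emeasure_density) (auto intro!: nn_integral_cong)
    also have "\<dots> = ennreal (\<integral>w. d w \<partial>\<eta>)" using d_int d0 by (intro nn_integral_eq_integral) auto
    finally show "emeasure \<theta> (space \<theta>) \<noteq> \<infinity>" by simp
  qed
  interpret T: finite_measure \<theta> by fact
  have ae\<theta>: "AE w in \<theta>. 0 < w \<and> w \<le> 1"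
    unfolding \<theta>_def by (subst AE_density) (use AE_\<eta> in auto)
  obtain \<nu> where \<nu>: "has_mellin \<nu> (\<lambda>z. exp (\<integral>w. (complex_of_real w powr z - 1) \<partial>\<theta>))"
    using compound_poisson_mellin[OF fin s\<theta> ae\<theta>] by blast
  define D where "D = (\<integral>w. (1 - w) \<partial>\<theta>)"
  have D_int: "integrable \<theta> (\<lambda>w. 1 - w)"
    by (rule T.integrable_const_bound[where B = 1])
       (use ae\<theta> in eventually_elim, auto simp: measurable_cong_sets[OF s\<theta> refl])
  have "has_mellin (prod_convolution (return borel (exp (c * L + D))) \<nu>)
      (\<lambda>z. of_real (exp (c * L + D)) powr z * exp (\<integral>w. (complex_of_real w powr z - 1) \<partial>\<theta>))"
    by (intro has_mellin_prod_convolution has_mellin_return \<nu>) simp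
  then have "has_mellin (prod_convolution (return borel (exp (c * L + D))) \<nu>)
      (\<lambda>z. exp (of_real c * cut_exponent m z))"
  proof (rule has_mellin_cong)
    fix z :: complex assume z: "0 \<le> Re z"
    have i1: "integrable \<theta> (\<lambda>w. complex_of_real w powr z - 1)"
    proof (rule T.integrable_const_bound[where B = 2])
      show "AE w in \<theta>. norm (complex_of_real w powr z - 1) \<le> 2"
        using ae\<theta>
      proof eventually_elim
        case (elim w)
        have "norm (complex_of_real w powr z) \<le> 1" using elim z by (simp add: norm_of_real_powr powr_le1)
        then show ?case using norm_triangle_ineq4[of "complex_of_real w powr z" 1] by simp
      qed
    qed (simp add: measurable_cong_sets[OF s\<theta> refl])
    have i2: "integrable \<theta> (\<lambda>w. z * complex_of_real (1 - w))"
      using D_int by (intro integrable_mult_right integrable_of_real)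
    have "(\<integral>w. (complex_of_real w powr z - 1) \<partial>\<theta>) + z * of_real D
        = (\<integral>w. (complex_of_real w powr z - 1) \<partial>\<theta>) + (\<integral>w. z * complex_of_real (1 - w) \<partial>\<theta>)"
      unfolding D_def by (simp only: integral_complex_of_real integral_mult_right_zero)
    also have "\<dots> = (\<integral>w. (complex_of_real w powr z - 1) + z * complex_of_real (1 - w) \<partial>\<theta>)"
      using i1 i2 by simp
    also have "\<dots> = (\<integral>w. d w *\<^sub>R ((complex_of_real w powr z - 1) + z * complex_of_real (1 - w)) \<partial>\<eta>)"
      unfolding \<theta>_def using d0 by (subst integral_density) auto
    also have "\<dots> = (\<integral>w. of_real c * (indicator {..1 - 1 / real (Suc m)} w *\<^sub>R levy_kernel z w) \<partial>\<eta>)"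
      by (intro Bochner_Integration.integral_cong refl)
         (auto simp: d_def levy_kernel_def scaleR_conv_of_real indicator_def)
    also have "\<dots> = of_real c * (\<integral>w. indicator {..1 - 1 / real (Suc m)} w *\<^sub>R levy_kernel z w \<partial>\<eta>)"
      by (rule integral_mult_right_zero)
    finally have eq: "(\<integral>w. (complex_of_real w powr z - 1) \<partial>\<theta>) + z * of_real D
      = of_real c * (\<integral>w. indicator {..1 - 1 / real (Suc m)} w *\<^sub>R levy_kernel z w \<partial>\<eta>)" .
    have "of_real (exp (c * L + D)) powr z * exp (\<integral>w. (complex_of_real w powr z - 1) \<partial>\<theta>)
        = exp (z * of_real (c * L + D) + (\<integral>w. (complex_of_real w powr z - 1) \<partial>\<theta>))"
      by (subst complex_powr_of_pos_real, rule exp_gt_zero, simp only: ln_exp, rule exp_add[symmetric])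
    also have "z * of_real (c * L + D) + (\<integral>w. (complex_of_real w powr z - 1) \<partial>\<theta>)
        = of_real c * (z * of_real L) + ((\<integral>w. (complex_of_real w powr z - 1) \<partial>\<theta>) + z * of_real D)"
      by (simp add: algebra_simps)
    also have "\<dots> = of_real c * cut_exponent m z"
      unfolding eq cut_exponent_def by (simp add: algebra_simps)
    finally show "of_real (exp (c * L + D)) powr z * exp (\<integral>w. (complex_of_real w powr z - 1) \<partial>\<theta>)
        = exp (of_real c * cut_exponent m z)" .
  qed
  then show ?thesis by blast
qed

text \<open>The kernel vanishes at \<open>z = 1\<close>, so all cut laws have the same mean and are tight. Along a
  subsequence they converge weakly, and for \<open>Re z > 0\<close> the function \<open>x\<^sup>z\<close>, extended by 0 to the
  nonpositive reals, is continuous with second moments given by the cut exponents at \<open>2 Re z\<close>, which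
  are bounded. The boundary \<open>Re z = 0\<close>, where this function is no longer continuous at 0, is reached
  from inside; its value at \<open>z = 0\<close> says that the limit law is concentrated on \<open>]0,\<infinity>[\<close>.\<close>

lemma exists_mellin:
  assumes c: "0 < c"
  shows "\<exists>\<mu>. has_mellin \<mu> (\<lambda>z. exp (of_real c * exponent z))"
proof -
  obtain X where X: "\<And>m. has_mellin (X m) (\<lambda>z. exp (of_real c * cut_exponent m z))"
    using exists_mellin_cut[OF c] by metis
  have pX: "prob_on {0<..} (X m)" for m using X[of m] by (auto simp: has_mellin_def)
  have aeX: "AE x in X m. 0 < x" and sX [measurable_cong]: "sets (X m) = sets borel" for m
    using pX[of m] by (auto simp: prob_on_pos_iff)
  have rdX: "real_distribution (X m)" for m
    using pX[of m] by (simp add: prob_on_pos_iff real_distribution_def real_distribution_axioms_def)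
  have rpow: "integrable (X m) (\<lambda>x. (max 0 x) powr a)"
    "(\<integral>x. (max 0 x) powr a \<partial>X m) = Re (exp (of_real c * cut_exponent m (of_real a)))"
    if a: "0 \<le> a" for a m
  proof -
    have "has_bochner_integral (X m) (\<lambda>x. Re (complex_of_real x powr of_real a))
        (Re (exp (of_real c * cut_exponent m (of_real a))))"
      by (rule has_bochner_integral_Re) (use X[of m] a in \<open>auto simp: has_mellin_def\<close>)
    also have "?this \<longleftrightarrow> has_bochner_integral (X m) (\<lambda>x. (max 0 x) powr a)
        (Re (exp (of_real c * cut_exponent m (of_real a))))"
    proof (rule has_bochner_integral_cong_AE)
      show "AE x in X m. Re (complex_of_real x powr of_real a) = max 0 x powr a"
        using aeX[of m] by eventually_elim (simp add: powr_of_real)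
    qed auto
    finally show "integrable (X m) (\<lambda>x. (max 0 x) powr a)"
      "(\<integral>x. (max 0 x) powr a \<partial>X m) = Re (exp (of_real c * cut_exponent m (of_real a)))"
      by (auto simp: has_bochner_integral_iff)
  qed
  have tight: "tight X"
    unfolding tight_def
  proof (intro conjI allI impI rdX)
    fix e :: real assume e: "0 < e"
    define K where "K = exp (c * L)"
    (* Markov's inequality for the common mean K; the factor 2 makes the estimate strict. *)
    define b where "b = 2 * K / e"
    have K: "K > 0" by (simp add: K_def)
    have b: "b > 0" using e K by (simp add: b_def)
    have "measure (X m) {- 1<..b} > 1 - e" for m
    proof -
      interpret M: real_distribution "X m" by (rule rdX)
      have "M.prob {x \<in> space (X m). b \<le> max 0 x powr 1} \<le> (\<integral>x. max 0 x powr 1 \<partial>X m) / b"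
        by (rule integral_Markov_inequality_measure[where A = "space (X m)"])
           (use rpow(1)[of 1 m] b in auto)
      also have "(\<integral>x. max 0 x powr 1 \<partial>X m) = K"
        using rpow(2)[of 1 m] cut_exponent_1[of m]
        by (simp add: K_def exp_of_real flip: of_real_mult)
      also have "K / b < e" using e K by (simp add: b_def)
      finally have 1: "M.prob {x. b \<le> max 0 x powr 1} < e" by simp
      have "1 = M.prob UNIV" using M.prob_space by simp
      also have "\<dots> \<le> M.prob ({- 1<..b} \<union> {x. b \<le> max 0 x powr 1} \<union> {..- 1})"
        by (rule M.finite_measure_mono) (auto simp: max_def powr_def)
      also have "\<dots> \<le> M.prob {- 1<..b} + M.prob {x. b \<le> max 0 x powr 1} + M.prob {..- 1}"
        by (intro order_trans[OF measure_Un_le] add_mono measure_Un_le) auto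
      also have "M.prob {..- 1} = 0"
      proof -
        have "AE x in X m. x \<notin> {..- 1}" using aeX[of m] by eventually_elim auto
        then have "{..- 1} \<in> null_sets (X m)" by (subst AE_iff_null_sets) auto
        then show ?thesis by (simp add: measure_eq_0_null_sets)
      qed
      finally show ?thesis using 1 by linarith
    qed
    then show "\<exists>a b. a < b \<and> (\<forall>m. measure (X m) {a<..b} > 1 - e)"
      using b by (intro exI[of _ "- 1"] exI[of _ b]) auto
  qed
  obtain r M where r: "strict_mono r" and rdM: "real_distribution M" and wc: "weak_conv_m (X \<circ> id \<circ> r) M"
    using tight_imp_convergent_subsubsequence[OF tight strict_mono_id] by blast
  interpret M: real_distribution M by fact
  (* The maximum extends the power continuously by 0 to the whole line when Re z > 0. *)
  define h where "h z x = complex_of_real (max 0 x) powr z" for z x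
  have h_meas [measurable]: "h z \<in> borel_measurable borel" for z unfolding h_def by measurable
  have h_norm: "norm (h z x) = max 0 x powr Re z" for z x by (simp add: h_def norm_of_real_powr)
  have lim: "integrable M (h z)" "integral\<^sup>L M (h z) = exp (of_real c * exponent z)"
    if z: "0 < Re z" for z
  proof -
    let ?B = "exp (c * (2 * Re z * \<bar>L\<bar> + 8 * (1 + 2 * Re z)\<^sup>2 * measure \<eta> (space \<eta>)))"
    have sq: "(norm (h z x))\<^sup>2 = max 0 x powr (2 * Re z)" for x
      by (simp add: h_norm power2_eq_square flip: powr_add)
    have bd: "(\<integral>x. (norm (h z x))\<^sup>2 \<partial>X m) \<le> ?B" for m
    proof -
      have "(\<integral>x. (norm (h z x))\<^sup>2 \<partial>X m) = Re (exp (of_real c * cut_exponent m (of_real (2 * Re z))))"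
        unfolding sq by (rule rpow) (use z in simp)
      also have "\<dots> \<le> norm (exp (of_real c * cut_exponent m (of_real (2 * Re z))))"
        by (rule complex_Re_le_cmod)
      also have "\<dots> \<le> exp (norm (of_real c * cut_exponent m (of_real (2 * Re z))))"
        by (rule norm_exp)
      also have "norm (of_real c * cut_exponent m (of_real (2 * Re z))) = c * norm (cut_exponent m (of_real (2 * Re z)))"
        using c by (simp add: norm_mult)
      also have "norm (cut_exponent m (of_real (2 * Re z)))
          \<le> norm (complex_of_real (2 * Re z)) * \<bar>L\<bar>
            + 8 * (1 + norm (complex_of_real (2 * Re z)))\<^sup>2 * measure \<eta> (space \<eta>)"
        by (rule norm_cut_exponent_le) (use z in simp)
      also have "norm (complex_of_real (2 * Re z)) = 2 * Re z"
        by (subst norm_of_real) (use z in simp)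
      finally show ?thesis using c by simp
    qed
    have wl: "integrable M (h z)" "(\<lambda>n. integral\<^sup>L ((X \<circ> id \<circ> r) n) (h z)) \<longlonglongrightarrow> integral\<^sup>L M (h z)"
    proof -
      have 1: "isCont (h z) x" for x unfolding h_def by (rule continuous_at_of_real_max_powr[OF z])
      have 2: "integrable (X m) (\<lambda>x. (norm (h z x))\<^sup>2)" for m
        unfolding sq by (rule rpow) (use z in simp)
      show "integrable M (h z)" "(\<lambda>n. integral\<^sup>L ((X \<circ> id \<circ> r) n) (h z)) \<longlonglongrightarrow> integral\<^sup>L M (h z)"
        using weak_conv_integral_bounded_second_moment[of "X \<circ> id \<circ> r" M "h z" ?B] rdX rdM wc 1 2 bd
        by simp_all
    qed
    have "integral\<^sup>L (X m) (h z) = exp (of_real c * cut_exponent m z)" for m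
    proof -
      have "integral\<^sup>L (X m) (h z) = (\<integral>x. complex_of_real x powr z \<partial>X m)"
      proof (rule integral_cong_AE)
        show "AE x in X m. h z x = complex_of_real x powr z"
          using aeX[of m] by eventually_elim (simp add: h_def)
      qed auto
      then show ?thesis using X[of m] z by (auto simp: has_mellin_def has_bochner_integral_iff)
    qed
    with wl(2) have "(\<lambda>n. exp (of_real c * cut_exponent (r n) z)) \<longlonglongrightarrow> integral\<^sup>L M (h z)"
      by simp
    moreover have "(\<lambda>n. exp (of_real c * cut_exponent (r n) z)) \<longlonglongrightarrow> exp (of_real c * exponent z)"
      using LIMSEQ_subseq_LIMSEQ[OF cut_exponent_tendsto r, of z] z
      by (intro tendsto_intros) (auto simp: o_def)
    ultimately show "integrable M (h z)" "integral\<^sup>L M (h z) = exp (of_real c * exponent z)"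
      using wl(1) LIMSEQ_unique by blast+
  qed
  have lim0: "has_bochner_integral M (\<lambda>x. indicator {0<..} x *\<^sub>R h z x) (exp (of_real c * exponent z))"
    if z: "0 \<le> Re z" for z
  proof -
    let ?z = "\<lambda>j. z + of_real (inverse (real (Suc j)))"
    have zlim: "?z \<longlonglongrightarrow> z"
      using tendsto_add[OF tendsto_const[of z] tendsto_of_real[OF LIMSEQ_inverse_real_of_nat]]
      by (simp only: of_real_0 add_0_right)
    have Rez: "Re z < Re (?z j)" "Re (?z j) \<le> Re z + 1" for j
      by (auto simp del: of_real_inverse simp: field_simps)
    (* The exponents Re (?z j) lie in ]0, Re z + 1], so 1 dominates on x <= 1 and the power with
       the largest exponent dominates beyond. *)
    have dom: "integrable M (\<lambda>x. 1 + norm (h (z + 1) x))"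
      using lim(1)[of "z + 1"] z by auto
    have ptw: "(\<lambda>j. h (?z j) x) \<longlonglongrightarrow> indicator {0<..} x *\<^sub>R h z x" for x
    proof (cases "0 < x")
      case True
      then have "h y x = exp (y * of_real (ln x))" for y
        by (simp add: h_def complex_powr_of_pos_real)
      moreover have "(\<lambda>j. exp (?z j * of_real (ln x))) \<longlonglongrightarrow> exp (z * of_real (ln x))"
        by (intro tendsto_intros zlim)
      ultimately show ?thesis using True by simp
    qed (simp add: h_def max_def)
    have bd: "norm (h (?z j) x) \<le> 1 + norm (h (z + 1) x)" for j x
    proof (cases "x \<le> 1")
      case True
      then have "norm (h (?z j) x) \<le> 1"
        unfolding h_norm using z Rez(1)[of j] by (intro powr_le1) auto
      then show ?thesis by (smt (verit) norm_ge_zero)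
    next
      case False
      then have "norm (h (?z j) x) \<le> norm (h (z + 1) x)"
        unfolding h_norm using Rez(2)[of j] by (intro powr_mono) auto
      then show ?thesis by simp
    qed
    have A: "(\<lambda>j. integral\<^sup>L M (h (?z j))) \<longlonglongrightarrow> (\<integral>x. indicator {0<..} x *\<^sub>R h z x \<partial>M)"
      and int: "integrable M (\<lambda>x. indicator {0<..} x *\<^sub>R h z x)"
    proof -
      have m: "(\<lambda>x. indicator {0<..} x *\<^sub>R h z x) \<in> borel_measurable M" by measurable
      have m': "h (?z j) \<in> borel_measurable M" for j by measurable
      note dc = m m' dom AE_I2[OF ptw] AE_I2[OF bd]
      show "(\<lambda>j. integral\<^sup>L M (h (?z j))) \<longlonglongrightarrow> (\<integral>x. indicator {0<..} x *\<^sub>R h z x \<partial>M)"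
        by (rule integral_dominated_convergence[OF dc])
      show "integrable M (\<lambda>x. indicator {0<..} x *\<^sub>R h z x)"
        by (rule integrable_dominated_convergence[OF dc])
    qed
    have "integral\<^sup>L M (h (?z j)) = exp (of_real c * exponent (?z j))" for j
      by (rule lim(2)) (use z Rez(1)[of j] in linarith)
    note A[unfolded this]
    moreover have "(\<lambda>j. exp (of_real c * exponent (?z j))) \<longlonglongrightarrow> exp (of_real c * exponent z)"
      by (intro tendsto_intros exponent_tendsto z)
    ultimately have "(\<integral>x. indicator {0<..} x *\<^sub>R h z x \<partial>M) = exp (of_real c * exponent z)"
      by (rule LIMSEQ_unique)
    with int show ?thesis by (simp add: has_bochner_integral_iff)
  qed
  have aeM: "AE x in M. 0 < x"
  proof -
    have "has_bochner_integral M (\<lambda>x. indicator {0<..} x *\<^sub>R h 0 x) 1"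
      using lim0[of 0] by (simp add: exponent_0)
    also have "(\<lambda>x. indicator {0<..} x *\<^sub>R h 0 x) = (\<lambda>x. complex_of_real (indicator {0<..} x))"
      by (auto simp: h_def fun_eq_iff indicator_def max_def)
    finally have "complex_of_real (M.prob {0<..}) = 1"
      by (simp add: has_bochner_integral_iff)
    then have "M.prob {0<..} = 1" by (simp only: of_real_eq_1_iff)
    then show ?thesis by (subst (asm) M.prob_eq_1) auto
  qed
  have "has_mellin M (\<lambda>z. exp (of_real c * exponent z))"
    unfolding has_mellin_def
  proof (intro conjI allI impI)
    show "prob_on {0<..} M" using aeM by (simp add: prob_on_pos_iff M.prob_space_axioms)
    fix z :: complex assume "0 \<le> Re z"
    from lim0[OF this] show "has_bochner_integral M (\<lambda>t. complex_of_real t powr z) (exp (of_real c * exponent z))"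
    proof (rule has_bochner_integral_cong_AE[THEN iffD1, rotated -1])
      show "AE x in M. indicator {0<..} x *\<^sub>R h z x = complex_of_real x powr z"
        using aeM by eventually_elim (simp add: h_def)
    qed auto
  qed
  then show ?thesis by blast
qed

end

section \<open>Determinacy of moment sequences of factorial growth\<close>

lemma fact_add_le: "(fact (n + j) :: real) \<le> 2 ^ (n + j) * fact n * fact j"
proof -
  have "(fact (n + j) :: real) = real ((n + j) choose n) * fact n * fact j"
    by (simp add: binomial_fact)
  also have "\<dots> \<le> real (2 ^ (n + j)) * fact n * fact j"
  proof (intro mult_right_mono of_nat_mono)
    have "((n + j) choose n) \<le> (\<Sum>k\<le>n + j. (n + j) choose k)"
      by (rule member_le_sum) auto
    then show "((n + j) choose n) \<le> 2 ^ (n + j)" by (simp add: choose_row_sum)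
  qed auto
  finally show ?thesis by simp
qed

text \<open>Up to the factor \<open>i\<^sup>n\<close>, the \<open>n\<close>-th derivative of the characteristic function.\<close>

definition moment_char :: "real measure \<Rightarrow> nat \<Rightarrow> real \<Rightarrow> complex" where
  "moment_char \<mu> n t = (\<integral>x. of_real (x ^ n) * iexp (t * x) \<partial>\<mu>)"

text \<open>The Taylor series of the \<open>n\<close>-th derivative about any real point \<open>t\<close>. Its radius of convergence
  is bounded below independently of \<open>t\<close> and \<open>n\<close>, because on \<open>[0,\<infinity>[\<close> the absolute moments are the
  moments: the terms are dominated by \<open>|h|\<^sup>j K\<^sup>n\<^sup>+\<^sup>j (n + j)! / j!\<close>, which is at most a constant
  times \<open>(2 K |h|)\<^sup>j\<close>.\<close>

lemma moment_char_taylor: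
  assumes p: "prob_on {0..} \<mu>" and m: "has_moments \<mu> s"
    and K: "K > 0" and s: "\<And>n. n \<ge> 1 \<Longrightarrow> s n \<le> K ^ n * fact n"
    and h: "\<bar>h\<bar> \<le> 1 / (4 * K)"
  shows "(\<lambda>j. (\<i> * of_real h) ^ j / fact j * moment_char \<mu> (n + j) t) sums moment_char \<mu> n (t + h)"
proof -
  interpret prob_space \<mu> using p by (simp add: prob_on_def)
  have sb [measurable_cong]: "sets \<mu> = sets borel" and ae: "AE x in \<mu>. 0 \<le> x"
    using p by (auto simp: prob_on_def borel_measure_on_iff_AE)
  have mom: "integrable \<mu> (\<lambda>x. x ^ k)" "(\<integral>x. x ^ k \<partial>\<mu>) \<le> K ^ k * fact k" for k
  proof -
    have "integrable \<mu> (\<lambda>x. x ^ k) \<and> (\<integral>x. x ^ k \<partial>\<mu>) \<le> K ^ k * fact k"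
    proof (cases "k = 0")
      case True
      then show ?thesis by (simp add: prob_space)
    next
      case False
      then have "has_bochner_integral \<mu> (\<lambda>x. x ^ k) (s k)"
        using m by (auto simp: has_moments_def)
      with s[of k] False show ?thesis by (auto simp: has_bochner_integral_iff)
    qed
    then show "integrable \<mu> (\<lambda>x. x ^ k)" "(\<integral>x. x ^ k \<partial>\<mu>) \<le> K ^ k * fact k" by auto
  qed
  define u where "u j x = (\<i> * of_real h) ^ j / fact j * (of_real (x ^ (n + j)) * iexp (t * x))" for j x
  have u_norm: "norm (u j x) = \<bar>h\<bar> ^ j / fact j * \<bar>x\<bar> ^ (n + j)" for j x
    by (simp add: u_def norm_mult norm_divide norm_power power_abs)
  have intx: "integrable \<mu> (\<lambda>x. of_real (x ^ k) * iexp (t * x))" for k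
    by (rule Bochner_Integration.integrable_bound[OF mom(1)[of k]])
       (auto simp: norm_mult norm_power power_abs)
  have u_int: "integrable \<mu> (u j)" for j
    unfolding u_def by (intro integrable_mult_right intx)
  have u_sums: "(\<lambda>j. u j x) sums (of_real (x ^ n) * iexp ((t + h) * x))" for x
  proof -
    have "(\<lambda>j. (\<i> * of_real (h * x)) ^ j /\<^sub>R fact j) sums iexp (h * x)"
      by (rule exp_converges)
    then have "(\<lambda>j. of_real (x ^ n) * iexp (t * x) * ((\<i> * of_real (h * x)) ^ j /\<^sub>R fact j))
        sums (of_real (x ^ n) * iexp (t * x) * iexp (h * x))"
      by (rule sums_mult)
    also have "(\<lambda>j. of_real (x ^ n) * iexp (t * x) * ((\<i> * of_real (h * x)) ^ j /\<^sub>R fact j)) = (\<lambda>j. u j x)"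
      by (auto simp: u_def fun_eq_iff power_mult_distrib power_add scaleR_conv_of_real field_simps)
    also have "of_real (x ^ n) * iexp (t * x) * iexp (h * x) = of_real (x ^ n) * iexp ((t + h) * x)"
      by (simp add: algebra_simps exp_add)
    finally show ?thesis .
  qed
  have summ: "summable (\<lambda>j. norm (u j x))" for x
  proof -
    have "summable (\<lambda>j. \<bar>x\<bar> ^ n * ((\<bar>h\<bar> * \<bar>x\<bar>) ^ j /\<^sub>R fact j))"
      by (intro summable_mult sums_summable[OF exp_converges])
    also have "(\<lambda>j. \<bar>x\<bar> ^ n * ((\<bar>h\<bar> * \<bar>x\<bar>) ^ j /\<^sub>R fact j)) = (\<lambda>j. norm (u j x))"
      by (auto simp: u_norm fun_eq_iff power_mult_distrib power_add field_simps)
    finally show ?thesis .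
  qed
  have summ_int: "summable (\<lambda>j. \<integral>x. norm (u j x) \<partial>\<mu>)"
  proof (rule summable_comparison_test)
    have "(\<integral>x. norm (u j x) \<partial>\<mu>) \<le> (2 * K) ^ n * fact n * (1 / 2) ^ j" for j
    proof -
      have "(\<integral>x. norm (u j x) \<partial>\<mu>) = (\<integral>x. \<bar>h\<bar> ^ j / fact j * x ^ (n + j) \<partial>\<mu>)"
      proof (rule integral_cong_AE)
        show "AE x in \<mu>. norm (u j x) = \<bar>h\<bar> ^ j / fact j * x ^ (n + j)"
          using ae by eventually_elim (simp add: u_norm)
      qed (auto simp: u_norm)
      also have "\<dots> = \<bar>h\<bar> ^ j / fact j * (\<integral>x. x ^ (n + j) \<partial>\<mu>)" by simp
      also have "\<dots> \<le> \<bar>h\<bar> ^ j / fact j * (K ^ (n + j) * (2 ^ (n + j) * fact n * fact j))"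
        using K by (intro mult_left_mono order_trans[OF mom(2)] fact_add_le) auto
      also have "\<dots> = (2 * K) ^ n * fact n * (2 * K * \<bar>h\<bar>) ^ j"
        by (simp add: field_simps power_add power_mult_distrib)
      also have "\<dots> \<le> (2 * K) ^ n * fact n * (1 / 2) ^ j"
        using h K by (intro mult_left_mono power_mono) (auto simp: field_simps)
      finally show ?thesis .
    qed
    then show "\<exists>N. \<forall>j\<ge>N. norm (\<integral>x. norm (u j x) \<partial>\<mu>) \<le> (2 * K) ^ n * fact n * (1 / 2) ^ j"
      by (intro exI[of _ 0]) (auto simp: abs_of_nonneg[OF integral_nonneg])
    show "summable (\<lambda>j. (2 * K) ^ n * fact n * (1 / 2 :: real) ^ j)"
      by (intro summable_mult summable_geometric) simp
  qed
  have "(\<lambda>j. integral\<^sup>L \<mu> (u j)) sums (\<integral>x. (\<Sum>j. u j x) \<partial>\<mu>)"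
    by (rule sums_integral) (use u_int summ summ_int in auto)
  also have "(\<integral>x. (\<Sum>j. u j x) \<partial>\<mu>) = moment_char \<mu> n (t + h)"
    unfolding moment_char_def using sums_unique[OF u_sums] by simp
  also have "(\<lambda>j. integral\<^sup>L \<mu> (u j)) = (\<lambda>j. (\<i> * of_real h) ^ j / fact j * moment_char \<mu> (n + j) t)"
    unfolding u_def moment_char_def by (simp only: integral_mult_right_zero)
  finally show ?thesis .
qed

text \<open>The moments fix all derivatives of the characteristic function at 0. Taylor expansion carries this
  from \<open>k h\<close> to \<open>(k + 1) h\<close> whenever \<open>|h| \<le> 1 / (4 K)\<close>, so that finitely many steps reach any real
  point.\<close>

lemma stieltjes_moment_determinacy:
  assumes p: "prob_on {0..} \<mu>" "prob_on {0..} \<nu>"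
    and m: "has_moments \<mu> s" "has_moments \<nu> s"
    and K: "K > 0" and s: "\<And>n. n \<ge> 1 \<Longrightarrow> s n \<le> K ^ n * fact n"
  shows "\<mu> = \<nu>"
proof -
  have eq: "moment_char \<mu> n (real k * h) = moment_char \<nu> n (real k * h)"
    if h: "\<bar>h\<bar> \<le> 1 / (4 * K)" for n k h
  proof (induction k arbitrary: n)
    case 0
    have "moment_char \<rho> n 0 = of_real (if n = 0 then 1 else s n)"
      if "prob_on {0..} \<rho>" "has_moments \<rho> s" for \<rho>
    proof (cases "n = 0")
      case True
      interpret prob_space \<rho> using that by (simp add: prob_on_def)
      show ?thesis using True prob_space by (simp add: moment_char_def scaleR_conv_of_real)
    next
      case False
      then have "has_bochner_integral \<rho> (\<lambda>x. x ^ n) (s n)"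
        using that by (auto simp: has_moments_def)
      then have "(\<integral>x. complex_of_real (x ^ n) \<partial>\<rho>) = of_real (s n)"
        by (simp only: integral_complex_of_real has_bochner_integral_iff)
      then show ?thesis using False by (simp add: moment_char_def)
    qed
    from this[OF p(1) m(1)] this[OF p(2) m(2)] show ?case by simp
  next
    case (Suc k)
    have "(\<lambda>j. (\<i> * of_real h) ^ j / fact j * moment_char \<mu> (n + j) (real k * h)) sums moment_char \<mu> n (real k * h + h)"
      by (rule moment_char_taylor[OF p(1) m(1) K s h])
    moreover have "(\<lambda>j. (\<i> * of_real h) ^ j / fact j * moment_char \<nu> (n + j) (real k * h)) sums moment_char \<nu> n (real k * h + h)"
      by (rule moment_char_taylor[OF p(2) m(2) K s h])
    ultimately have "moment_char \<mu> n (real k * h + h) = moment_char \<nu> n (real k * h + h)"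
      unfolding Suc by (rule sums_unique2)
    then show ?case by (simp add: algebra_simps)
  qed
  have "char \<mu> t = char \<nu> t" for t
  proof -
    obtain k where k: "4 * K * \<bar>t\<bar> \<le> real k" using real_arch_simple by blast
    have "\<bar>t / real (Suc k)\<bar> \<le> 1 / (4 * K)" using k K by (simp add: field_simps)
    from eq[OF this, of 0 "Suc k"] show ?thesis by (simp add: moment_char_def char_def del: of_nat_Suc)
  qed
  then show ?thesis
    using p by (intro Levy_uniqueness ext)
      (auto simp: prob_on_def borel_measure_on_def real_distribution_def real_distribution_axioms_def)
qed

section \<open>Bernstein functions\<close>

text \<open>Differentiation under the integral sign: by the mean value theorem the dominating function of the
  derivatives also dominates the difference quotients.\<close>

lemma has_real_derivative_integral:
  fixes F :: "real \<Rightarrow> 'a \<Rightarrow> real"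
  assumes u: "u \<in> {a<..<b}"
    and int: "\<And>v. v \<in> {a<..<b} \<Longrightarrow> integrable M (F v)"
    and meas: "F' u \<in> borel_measurable M" and w: "integrable M w"
    and der: "AE x in M. \<forall>v\<in>{a<..<b}. ((\<lambda>v. F v x) has_real_derivative F' v x) (at v) \<and> \<bar>F' v x\<bar> \<le> w x"
  shows "((\<lambda>v. \<integral>x. F v x \<partial>M) has_real_derivative (\<integral>x. F' u x \<partial>M)) (at u)"
  unfolding has_field_derivative_iff tendsto_at_iff_sequentially o_def
proof (intro allI impI)
  fix X :: "nat \<Rightarrow> real" assume X: "\<forall>i. X i \<in> UNIV - {u}" "X \<longlonglongrightarrow> u"
  have "\<forall>\<^sub>F i in sequentially. X i \<in> {a<..<b}"
    by (rule topological_tendstoD[OF X(2)]) (use u in auto)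
  then obtain N where N: "\<And>i. i \<ge> N \<Longrightarrow> X i \<in> {a<..<b}" by (auto simp: eventually_sequentially)
  define Y where "Y i = X (i + N)" for i
  have Y: "Y i \<in> {a<..<b}" "Y i \<noteq> u" for i using N X(1) by (auto simp: Y_def)
  have Ylim: "Y \<longlonglongrightarrow> u" unfolding Y_def by (rule LIMSEQ_ignore_initial_segment[OF X(2)])
  have lim: "(\<lambda>i. \<integral>x. (F (Y i) x - F u x) / (Y i - u) \<partial>M) \<longlonglongrightarrow> (\<integral>x. F' u x \<partial>M)"
  proof (rule integral_dominated_convergence[OF meas _ w])
    show "(\<lambda>x. (F (Y i) x - F u x) / (Y i - u)) \<in> borel_measurable M" for i
      using int[OF Y(1)[of i]] int[OF u] by measurable
    show "AE x in M. (\<lambda>i. (F (Y i) x - F u x) / (Y i - u)) \<longlonglongrightarrow> F' u x"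
      using der
    proof eventually_elim
      case (elim x)
      then have "((\<lambda>v. (F v x - F u x) / (v - u)) \<longlongrightarrow> F' u x) (at u)"
        using u by (simp add: has_field_derivative_iff)
      then show ?case
        using Y Ylim unfolding tendsto_at_iff_sequentially o_def by auto
    qed
    show "AE x in M. norm ((F (Y i) x - F u x) / (Y i - u)) \<le> w x" for i
      using der
    proof eventually_elim
      case (elim x)
      have "norm (F (Y i) x - F u x) \<le> w x * norm (Y i - u)"
        by (rule field_differentiable_bound[where S = "{a<..<b}" and f' = "\<lambda>v. F' v x"])
           (use elim u Y in \<open>auto intro: has_field_derivative_at_within\<close>)
      then show ?case using Y(2)[of i] by (simp add: divide_le_eq)
    qed
  qed
  have quot: "(\<integral>x. (F (Y i) x - F u x) / (Y i - u) \<partial>M)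
      = ((\<integral>x. F (Y i) x \<partial>M) - (\<integral>x. F u x \<partial>M)) / (Y i - u)" for i
    by (simp only: integral_divide_zero Bochner_Integration.integral_diff[OF int[OF Y(1)[of i]] int[OF u]])
  from lim[unfolded quot]
  show "(\<lambda>i. ((\<integral>x. F (X i) x \<partial>M) - (\<integral>x. F u x \<partial>M)) / (X i - u)) \<longlonglongrightarrow> (\<integral>x. F' u x \<partial>M)"
    unfolding Y_def by (rule LIMSEQ_offset)
qed

locale bernstein_representation =
  fixes f :: "real \<Rightarrow> real" and a b :: real and \<nu> :: "real measure"
  assumes a: "0 \<le> a" and b: "0 \<le> b"
    and sets_\<nu> [simp, measurable_cong]: "sets \<nu> = sets borel"
    and AE_\<nu>: "AE x in \<nu>. 0 < x"
    and integrable_\<nu>: "integrable \<nu> (\<lambda>x. x / (1 + x))"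
    and f_eq: "\<And>s. 0 \<le> s \<Longrightarrow> f s = a + b * s + (\<integral>x. (1 - exp (- (s * x))) \<partial>\<nu>)"
begin

lemma one_minus_exp_bounds:
  fixes s x :: real
  assumes "0 \<le> s" "0 < x"
  shows "0 \<le> 1 - exp (- (s * x))" "1 - exp (- (s * x)) \<le> (1 + s) * (x / (1 + x))"
proof -
  have "0 \<le> s * x" using assms by (intro mult_nonneg_nonneg) auto
  then show "0 \<le> 1 - exp (- (s * x))" by simp
  have "1 - exp (- (s * x)) \<le> s * x" using exp_ge_add_one_self[of "- (s * x)"] by simp
  moreover have "x * (1 - exp (- (s * x))) \<le> x * 1" using assms by (intro mult_left_mono) auto
  ultimately have "(1 + x) * (1 - exp (- (s * x))) \<le> (1 + s) * x" by (simp add: algebra_simps)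
  then show "1 - exp (- (s * x)) \<le> (1 + s) * (x / (1 + x))"
    using assms by (simp add: field_simps)
qed

lemma integrable_one_minus_exp:
  assumes "0 \<le> s" shows "integrable \<nu> (\<lambda>x. 1 - exp (- (s * x)))"
proof (rule Bochner_Integration.integrable_bound)
  show "integrable \<nu> (\<lambda>x. (1 + s) * (x / (1 + x)))" by (rule integrable_mult_right[OF integrable_\<nu>])
  show "AE x in \<nu>. norm (1 - exp (- (s * x))) \<le> norm ((1 + s) * (x / (1 + x)))"
    using AE_\<nu>
  proof eventually_elim
    case (elim x)
    then show ?case using one_minus_exp_bounds[OF assms elim] assms by simp
  qed
qed measurable

lemma linear_bound: "\<exists>K>0. \<forall>s\<ge>0. f s \<le> K * (1 + s)"
proof -
  define J where "J = (\<integral>x. x / (1 + x) \<partial>\<nu>)"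
  have "f s \<le> (a + b + J + 1) * (1 + s)" if s: "0 \<le> s" for s
  proof -
    have "(\<integral>x. (1 - exp (- (s * x))) \<partial>\<nu>) \<le> (\<integral>x. (1 + s) * (x / (1 + x)) \<partial>\<nu>)"
    proof (rule integral_mono_AE)
      show "AE x in \<nu>. 1 - exp (- (s * x)) \<le> (1 + s) * (x / (1 + x))"
        using AE_\<nu> by eventually_elim (rule one_minus_exp_bounds[OF s])
    qed (rule integrable_one_minus_exp[OF s], rule integrable_mult_right[OF integrable_\<nu>])
    also have "\<dots> = (1 + s) * J" unfolding J_def by (rule integral_mult_right_zero)
    finally have "f s \<le> a + b * s + (1 + s) * J" using s by (simp add: f_eq)
    also have "\<dots> \<le> (a + b + J + 1) * (1 + s)"
    proof -
      have "0 \<le> a * s" "0 \<le> b" using s a b by auto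
      then show ?thesis using s by (simp add: algebra_simps)
    qed
    finally show ?thesis .
  qed
  moreover have "0 \<le> J"
    unfolding J_def by (rule integral_nonneg_AE) (use AE_\<nu> in eventually_elim, simp)
  ultimately show ?thesis using a b by (intro exI[of _ "a + b + J + 1"]) auto
qed

lemma mono_f:
  assumes "0 \<le> s" "s \<le> t" shows "f s \<le> f t"
proof -
  have "(\<integral>x. (1 - exp (- (s * x))) \<partial>\<nu>) \<le> (\<integral>x. (1 - exp (- (t * x))) \<partial>\<nu>)"
  proof (rule integral_mono_AE)
    show "AE x in \<nu>. 1 - exp (- (s * x)) \<le> 1 - exp (- (t * x))"
      using AE_\<nu> by eventually_elim (use assms in \<open>simp add: mult_right_mono\<close>)
  qed (use assms in \<open>auto intro!: integrable_one_minus_exp\<close>)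
  moreover have "b * s \<le> b * t" using assms b by (intro mult_left_mono) auto
  ultimately show ?thesis using assms by (simp add: f_eq)
qed

text \<open>Pointwise this is convexity of the exponential function between \<open>0\<close> and \<open>- t x\<close>; it transports
  positivity of \<open>f\<close> at one point to the points on its left.\<close>

lemma concave_f:
  assumes "0 \<le> s" "s \<le> t" "0 < t" shows "s / t * f t \<le> f s"
proof -
  define r where "r = s / t"
  have r: "0 \<le> r" "r \<le> 1" "s = r * t" using assms by (auto simp: r_def)
  have pt: "r * (1 - exp (- (t * x))) \<le> 1 - exp (- (s * x))" for x
  proof -
    have "exp ((1 - r) *\<^sub>R 0 + r *\<^sub>R (- (t * x))) \<le> (1 - r) * exp 0 + r * exp (- (t * x))"
      by (rule convex_onD[OF exp_convex]) (use r in auto)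
    then show ?thesis by (simp add: r(3) algebra_simps)
  qed
  have "r * (\<integral>x. (1 - exp (- (t * x))) \<partial>\<nu>) = (\<integral>x. r * (1 - exp (- (t * x))) \<partial>\<nu>)"
    by (rule integral_mult_right_zero[symmetric])
  also have "\<dots> \<le> (\<integral>x. (1 - exp (- (s * x))) \<partial>\<nu>)"
    using pt assms by (intro integral_mono integrable_mult_right integrable_one_minus_exp) auto
  finally have "r * (\<integral>x. (1 - exp (- (t * x))) \<partial>\<nu>) \<le> (\<integral>x. (1 - exp (- (s * x))) \<partial>\<nu>)" .
  moreover have "r * a \<le> a" using r a by (simp add: mult_left_le_one_le)
  ultimately show ?thesis
    using assms r by (simp add: f_eq r_def[symmetric] algebra_simps)
qed

lemma f_pos:
  assumes "0 \<le> \<alpha>" "0 < f \<alpha>" "0 < s" shows "0 < f s"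
proof (cases "\<alpha> \<le> s")
  case True
  then show ?thesis using mono_f[of \<alpha> s] assms by linarith
next
  case False
  then have "s / \<alpha> * f \<alpha> \<le> f s" using assms by (intro concave_f) auto
  moreover have "0 < s / \<alpha> * f \<alpha>" using False assms by (intro mult_pos_pos divide_pos_pos) auto
  ultimately show ?thesis by linarith
qed

text \<open>Needed at 0, where \<open>f\<close> need not be differentiable.\<close>

lemma right_continuous_f:
  assumes "0 \<le> s" "\<And>i. s \<le> S i" "S \<longlonglongrightarrow> s" "\<And>i. S i \<le> t"
  shows "(\<lambda>i. f (S i)) \<longlonglongrightarrow> f s"
proof -
  have t: "0 \<le> t" using assms(1) assms(2)[of 0] assms(4)[of 0] by linarith
  have S0: "0 \<le> S i" for i using assms(1) assms(2)[of i] by linarith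
  have "(\<lambda>i. \<integral>x. (1 - exp (- (S i * x))) \<partial>\<nu>) \<longlonglongrightarrow> (\<integral>x. (1 - exp (- (s * x))) \<partial>\<nu>)"
  proof (rule integral_dominated_convergence[OF _ _ integrable_one_minus_exp[OF t]])
    show "AE x in \<nu>. (\<lambda>i. 1 - exp (- (S i * x))) \<longlonglongrightarrow> 1 - exp (- (s * x))"
      by (intro AE_I2 tendsto_intros assms)
    show "AE x in \<nu>. norm (1 - exp (- (S i * x))) \<le> 1 - exp (- (t * x))" for i
      using AE_\<nu>
    proof eventually_elim
      case (elim x)
      have "S i * x \<le> t * x" using elim assms by (intro mult_right_mono) auto
      then show ?case using elim S0[of i] by simp
    qed
  qed measurable
  then have "(\<lambda>i. a + b * S i + (\<integral>x. (1 - exp (- (S i * x))) \<partial>\<nu>)) \<longlonglongrightarrow> a + b * s + (\<integral>x. (1 - exp (- (s * x))) \<partial>\<nu>)"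
    by (intro tendsto_intros assms)
  then show ?thesis using f_eq S0 assms(1) by simp
qed

lemma integrable_x_exp:
  assumes d: "0 < d" shows "integrable \<nu> (\<lambda>x. x * exp (- (d * x)))"
proof (rule Bochner_Integration.integrable_bound)
  show "integrable \<nu> (\<lambda>x. (1 + 1 / d) * (x / (1 + x)))" by (rule integrable_mult_right[OF integrable_\<nu>])
  show "AE x in \<nu>. norm (x * exp (- (d * x))) \<le> norm ((1 + 1 / d) * (x / (1 + x)))"
    using AE_\<nu>
  proof eventually_elim
    case (elim x)
    have "d * x \<le> exp (d * x)" using exp_ge_add_one_self[of "d * x"] by linarith
    then have 1: "x * exp (- (d * x)) \<le> 1 / d" using d by (simp add: exp_minus field_simps)
    have 2: "exp (- (d * x)) \<le> 1" using d elim by simp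
    have "x * exp (- (d * x)) * (1 + x) = x * (exp (- (d * x)) + x * exp (- (d * x)))"
      by (simp add: algebra_simps)
    also have "\<dots> \<le> x * (1 + 1 / d)" using 1 2 elim by (intro mult_left_mono add_mono) auto
    finally have "x * exp (- (d * x)) \<le> (1 + 1 / d) * (x / (1 + x))"
      using elim by (simp add: pos_le_divide_eq mult.commute)
    then show ?case using elim d by (simp add: abs_mult)
  qed
qed measurable

lemma DERIV_f:
  assumes s: "0 < s"
  shows "(f has_real_derivative b + (\<integral>x. x * exp (- (s * x)) \<partial>\<nu>)) (at s)"
proof -
  have "((\<lambda>v. \<integral>x. (1 - exp (- (v * x))) \<partial>\<nu>) has_real_derivative (\<integral>x. x * exp (- (s * x)) \<partial>\<nu>)) (at s)"
  proof (rule has_real_derivative_integral[where a = "s / 2" and b = "2 * s"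
        and F' = "\<lambda>v x. x * exp (- (v * x))"])
    show "integrable \<nu> (\<lambda>x. x * exp (- (s / 2 * x)))" using s by (intro integrable_x_exp) simp
    show "AE x in \<nu>. \<forall>v\<in>{s / 2<..<2 * s}. ((\<lambda>v. 1 - exp (- (v * x))) has_real_derivative x * exp (- (v * x))) (at v)
        \<and> \<bar>x * exp (- (v * x))\<bar> \<le> x * exp (- (s / 2 * x))"
      using AE_\<nu>
    proof eventually_elim
      case (elim x)
      then show ?case
        by (auto simp: abs_mult intro!: derivative_eq_intros mult_right_mono)
    qed
  qed (use s in \<open>auto intro!: integrable_one_minus_exp\<close>)
  then have "((\<lambda>v. a + b * v + (\<integral>x. (1 - exp (- (v * x))) \<partial>\<nu>)) has_real_derivative
      b + (\<integral>x. x * exp (- (s * x)) \<partial>\<nu>)) (at s)"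
    by (auto intro!: derivative_eq_intros)
  moreover have "\<forall>\<^sub>F v in nhds s. a + b * v + (\<integral>x. (1 - exp (- (v * x))) \<partial>\<nu>) = f v"
    using eventually_nhds_in_open[of "{0<..}" s] s by (auto elim!: eventually_mono simp: f_eq)
  ultimately show ?thesis
    by (subst (asm) DERIV_cong_ev[OF refl _ refl]) auto
qed

text \<open>From \<open>1 + s x \<le> e\<^sup>s\<^sup>x\<close>. It shows that \<open>f'/f\<close> decays at infinity.\<close>

lemma deriv_f_le:
  assumes s: "0 < s" shows "s * deriv f s \<le> f s"
proof -
  have "s * (\<integral>x. x * exp (- (s * x)) \<partial>\<nu>) = (\<integral>x. s * (x * exp (- (s * x))) \<partial>\<nu>)"
    by (rule integral_mult_right_zero[symmetric])
  also have "\<dots> \<le> (\<integral>x. (1 - exp (- (s * x))) \<partial>\<nu>)"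
  proof (rule integral_mono)
    show "s * (x * exp (- (s * x))) \<le> 1 - exp (- (s * x))" for x
      using exp_ge_add_one_self[of "s * x"] by (simp add: exp_minus field_simps)
  qed (use s in \<open>auto intro!: integrable_x_exp integrable_one_minus_exp\<close>)
  finally show ?thesis
    using DERIV_imp_deriv[OF DERIV_f[OF s]] a b s by (simp add: f_eq algebra_simps)
qed

end

lemma bernstein_function_representation:
  assumes "bernstein_function f"
  obtains a b \<nu> where "bernstein_representation f a b \<nu>"
  using assms unfolding bernstein_function_def bernstein_representation_def
  by (auto simp: borel_measure_on_iff_AE)

section \<open>The logarithm of a Bernstein function\<close>

locale bernstein_log_derivative = bernstein_representation +
  fixes \<alpha> :: real and \<kappa> :: "real measure"
  assumes \<alpha>: "0 \<le> \<alpha>" and f\<alpha>: "0 < f \<alpha>"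
    and sets_\<kappa> [simp, measurable_cong]: "sets \<kappa> = sets borel"
    and AE_\<kappa>_nonneg: "AE x in \<kappa>. 0 \<le> x"
    and laplace_\<kappa>: "\<And>s. 0 < s \<Longrightarrow> has_bochner_integral \<kappa> (\<lambda>x. exp (- (s * x))) (deriv f s / f s)"
begin

lemma f_pos': "0 < s \<Longrightarrow> 0 < f s"
  using f_pos[OF \<alpha> f\<alpha>] .

text \<open>The mass of \<open>\<kappa>\<close> at 0 is at most \<open>f'(s) / f(s) \<le> 1 / s\<close> for all \<open>s\<close>.\<close>

lemma AE_\<kappa>: "AE x in \<kappa>. 0 < x"
proof -
  have "emeasure \<kappa> {0} \<le> ennreal (inverse (real (Suc n)))" for n
  proof -
    define s where "s = real (Suc n)"
    have s: "0 < s" by (simp add: s_def)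
    have "emeasure \<kappa> {0} = (\<integral>\<^sup>+x. indicator {0} x \<partial>\<kappa>)" by simp
    also have "\<dots> \<le> (\<integral>\<^sup>+x. ennreal (exp (- (s * x))) \<partial>\<kappa>)"
      by (intro nn_integral_mono) (auto simp: indicator_def)
    also have "\<dots> = ennreal (deriv f s / f s)"
      using laplace_\<kappa>[OF s] by (subst nn_integral_eq_integral) (auto simp: has_bochner_integral_iff)
    also have "\<dots> \<le> ennreal (inverse s)"
      using deriv_f_le[OF s] f_pos'[OF s] s by (intro ennreal_leI) (simp add: field_simps)
    finally show ?thesis by (simp add: s_def)
  qed
  moreover have "(\<lambda>n. ennreal (inverse (real (Suc n)))) \<longlonglongrightarrow> ennreal 0"
    by (intro tendsto_ennrealI LIMSEQ_inverse_real_of_nat)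
  ultimately have "emeasure \<kappa> {0} \<le> ennreal 0"
    by (intro LIMSEQ_le_const) auto
  then have "{0} \<in> null_sets \<kappa>" by (auto simp: null_sets_def)
  then have "AE x in \<kappa>. x \<notin> {0}" by (subst AE_iff_null_sets[symmetric]) auto
  with AE_\<kappa>_nonneg show ?thesis by eventually_elim auto
qed

lemma integrable_exp_diff_quotient:
  assumes "0 < s" "0 < t"
  shows "integrable \<kappa> (\<lambda>x. (exp (- (s * x)) - exp (- (t * x))) / x)"
proof -
  have le: "integrable \<kappa> (\<lambda>x. (exp (- (s * x)) - exp (- (t * x))) / x)" if s: "0 < s" "s \<le> t" for s t
  proof (rule Bochner_Integration.integrable_bound)
    show "integrable \<kappa> (\<lambda>x. (t - s) * exp (- (s * x)))"
      using laplace_\<kappa>[OF s(1)] by (simp add: has_bochner_integral_iff)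
    show "AE x in \<kappa>. norm ((exp (- (s * x)) - exp (- (t * x))) / x) \<le> norm ((t - s) * exp (- (s * x)))"
      using AE_\<kappa>
    proof eventually_elim
      case (elim x)
      have "exp (- (s * x)) - exp (- (t * x)) = exp (- (s * x)) * (1 - exp (- ((t - s) * x)))"
        by (simp add: algebra_simps flip: exp_add)
      also have "\<dots> \<le> exp (- (s * x)) * ((t - s) * x)"
        using exp_ge_add_one_self[of "- ((t - s) * x)"] by (intro mult_left_mono) auto
      finally have "exp (- (s * x)) - exp (- (t * x)) \<le> exp (- (s * x)) * ((t - s) * x)" .
      moreover have "exp (- (t * x)) \<le> exp (- (s * x))" using s elim by simp
      ultimately show ?case using s elim by (simp add: abs_mult field_simps)
    qed
  qed measurable
  show ?thesis
  proof (cases "s \<le> t")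
    case True
    then show ?thesis using le assms by blast
  next
    case False
    then have "integrable \<kappa> (\<lambda>x. - ((exp (- (t * x)) - exp (- (s * x))) / x))"
      using le[of t s] assms by (intro Bochner_Integration.integrable_minus) auto
    also have "(\<lambda>x. - ((exp (- (t * x)) - exp (- (s * x))) / x)) = (\<lambda>x. (exp (- (s * x)) - exp (- (t * x))) / x)"
      by (rule ext) (metis minus_diff_eq minus_divide_left)
    finally show ?thesis .
  qed
qed

text \<open>Both sides vanish at \<open>t = s\<close> and have the derivative \<open>f'(t) / f(t)\<close> in \<open>t\<close>.\<close>

lemma integral_exp_diff_quotient:
  assumes s: "0 < s" and t: "0 < t"
  shows "(\<integral>x. (exp (- (s * x)) - exp (- (t * x))) / x \<partial>\<kappa>) = ln (f t) - ln (f s)"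
proof -
  (* H is constant, and its value at s is ln (f s). *)
  define H where "H v = ln (f v) - (\<integral>x. (exp (- (s * x)) - exp (- (v * x))) / x \<partial>\<kappa>)" for v
  have "(H has_real_derivative 0) (at v)" if v: "0 < v" for v
  proof -
    have "(f has_real_derivative deriv f v) (at v)"
      using DERIV_f[OF v] by (metis DERIV_imp_deriv)
    then have 1: "((\<lambda>v. ln (f v)) has_real_derivative deriv f v / f v) (at v)"
      using f_pos'[OF v] by (auto intro!: derivative_eq_intros)
    have 2: "((\<lambda>v. \<integral>x. (exp (- (s * x)) - exp (- (v * x))) / x \<partial>\<kappa>) has_real_derivative
        (\<integral>x. exp (- (v * x)) \<partial>\<kappa>)) (at v)"
    proof (rule has_real_derivative_integral[where a = "v / 2" and b = "2 * v"
          and F' = "\<lambda>v x. exp (- (v * x))"])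
      show "integrable \<kappa> (\<lambda>x. exp (- (v / 2 * x)))"
        using laplace_\<kappa>[of "v / 2"] v by (simp add: has_bochner_integral_iff)
      show "AE x in \<kappa>. \<forall>u\<in>{v / 2<..<2 * v}.
          ((\<lambda>u. (exp (- (s * x)) - exp (- (u * x))) / x) has_real_derivative exp (- (u * x))) (at u)
          \<and> \<bar>exp (- (u * x))\<bar> \<le> exp (- (v / 2 * x))"
        using AE_\<kappa>
      proof eventually_elim
        case (elim x)
        show ?case
        proof (intro ballI conjI)
          fix u assume u: "u \<in> {v / 2<..<2 * v}"
          show "((\<lambda>u. (exp (- (s * x)) - exp (- (u * x))) / x) has_real_derivative exp (- (u * x))) (at u)"
            using elim by (auto intro!: derivative_eq_intros)
          show "\<bar>exp (- (u * x))\<bar> \<le> exp (- (v / 2 * x))"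
            using elim u by (simp add: mult_right_mono)
        qed
      qed
    qed (use v s in \<open>auto intro!: integrable_exp_diff_quotient\<close>)
    have "(\<integral>x. exp (- (v * x)) \<partial>\<kappa>) = deriv f v / f v"
      using laplace_\<kappa>[OF v] by (simp add: has_bochner_integral_iff)
    with DERIV_diff[OF 1 2] show ?thesis unfolding H_def by simp
  qed
  then have "H s = H t"
    by (intro DERIV_isconst3[of 0 "s + t"]) (use s t in auto)
  then show ?thesis by (simp add: H_def)
qed

text \<open>The lower end point \<open>\<alpha>\<close> may be 0, where the Laplace transform of \<open>\<kappa>\<close> may diverge. The integrands
  increase as the lower end point decreases to \<open>\<alpha>\<close>, so monotone convergence and \<open>f(\<alpha>) > 0\<close> give
  integrability in the limit.\<close>

lemma log_increment:
  assumes t: "\<alpha> \<le> t"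
  shows "has_bochner_integral \<kappa> (\<lambda>x. (exp (- (\<alpha> * x)) - exp (- (t * x))) / x) (ln (f t) - ln (f \<alpha>))"
proof (cases "t = \<alpha>")
  case True
  then show ?thesis by (simp add: has_bochner_integral_zero)
next
  case False
  define S where "S i = \<alpha> + (t - \<alpha>) * inverse (real (Suc i))" for i
  have S1: "\<alpha> < S i" for i using False t by (simp add: S_def)
  then have S0: "0 < S i" for i using \<alpha> by (meson le_less_trans)
  have S2: "S i \<le> t" for i
  proof -
    have "inverse (real (Suc i)) \<le> 1" by (simp add: field_simps)
    then have "(t - \<alpha>) * inverse (real (Suc i)) \<le> (t - \<alpha>) * 1"
      using t by (intro mult_left_mono) auto
    then show ?thesis by (simp add: S_def)
  qed
  have S3: "S j \<le> S i" if "i \<le> j" for i j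
    using that t unfolding S_def by (intro add_left_mono mult_left_mono le_imp_inverse_le) auto
  have Slim: "S \<longlonglongrightarrow> \<alpha>"
    unfolding S_def
    using tendsto_add[OF tendsto_const[of \<alpha>] tendsto_mult[OF tendsto_const[of "t - \<alpha>"] LIMSEQ_inverse_real_of_nat]]
    by simp
  have t0: "0 < t" using False t \<alpha> by linarith
  show ?thesis
  proof (rule has_bochner_integral_monotone_convergence)
    show "integrable \<kappa> (\<lambda>x. (exp (- (S i * x)) - exp (- (t * x))) / x)" for i
      by (rule integrable_exp_diff_quotient[OF S0 t0])
    show "AE x in \<kappa>. mono (\<lambda>i. (exp (- (S i * x)) - exp (- (t * x))) / x)"
      using AE_\<kappa>
      by eventually_elim (auto intro!: monoI divide_right_mono diff_right_mono mult_right_mono S3)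
    show "AE x in \<kappa>. (\<lambda>i. (exp (- (S i * x)) - exp (- (t * x))) / x)
        \<longlonglongrightarrow> (exp (- (\<alpha> * x)) - exp (- (t * x))) / x"
      using AE_\<kappa> by eventually_elim (intro tendsto_intros Slim, simp)
    have "(\<lambda>i. f (S i)) \<longlonglongrightarrow> f \<alpha>"
      by (rule right_continuous_f[OF \<alpha> less_imp_le[OF S1] Slim S2])
    then have "(\<lambda>i. ln (f t) - ln (f (S i))) \<longlonglongrightarrow> ln (f t) - ln (f \<alpha>)"
      using f\<alpha> by (intro tendsto_intros) auto
    then show "(\<lambda>i. \<integral>x. (exp (- (S i * x)) - exp (- (t * x))) / x \<partial>\<kappa>) \<longlonglongrightarrow> ln (f t) - ln (f \<alpha>)"
      using integral_exp_diff_quotient[OF S0 t0] by simp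
  qed measurable
qed

definition kolmogorov_density :: "real \<Rightarrow> real \<Rightarrow> real" where
  "kolmogorov_density \<beta> x = (exp (- (\<alpha> * x)) - exp (- ((\<alpha> + \<beta>) * x))) / x"

text \<open>The finite measure of the exponent in the variable \<open>w = e\<^sup>-\<^sup>\<beta>\<^sup>x\<close>, after the Kolmogorov form of the
  Levy-Khintchine formula; its density also equals \<open>(1 - w) e\<^sup>-\<^sup>\<alpha>\<^sup>x / x\<close>.\<close>

definition kolmogorov_measure :: "real \<Rightarrow> real measure" where
  "kolmogorov_measure \<beta> = distr (density \<kappa> (kolmogorov_density \<beta>)) borel (\<lambda>x. exp (- (\<beta> * x)))"

lemma kolmogorov_density_measurable [measurable]: "kolmogorov_density \<beta> \<in> borel_measurable borel"
  unfolding kolmogorov_density_def by measurable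

lemma AE_kolmogorov_density: "0 < \<beta> \<Longrightarrow> AE x in \<kappa>. 0 \<le> kolmogorov_density \<beta> x"
  using AE_\<kappa> by eventually_elim (auto simp: kolmogorov_density_def intro!: divide_nonneg_pos mult_right_mono)

lemma levy_data_kolmogorov_measure:
  assumes \<beta>: "0 < \<beta>" shows "levy_data (kolmogorov_measure \<beta>)"
  unfolding levy_data_def levy_data_axioms_def
proof (intro conjI)
  have hb: "has_bochner_integral \<kappa> (kolmogorov_density \<beta>) (ln (f (\<alpha> + \<beta>)) - ln (f \<alpha>))"
    unfolding kolmogorov_density_def by (rule log_increment) (use \<beta> in simp)
  have "emeasure (density \<kappa> (kolmogorov_density \<beta>)) (space \<kappa>) = (\<integral>\<^sup>+x. ennreal (kolmogorov_density \<beta> x) \<partial>\<kappa>)"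
    by (subst emeasure_density) (auto intro!: nn_integral_cong simp: sets_eq_imp_space_eq[OF sets_\<kappa>])
  also have "\<dots> = ennreal (ln (f (\<alpha> + \<beta>)) - ln (f \<alpha>))"
    using hb AE_kolmogorov_density[OF \<beta>] by (subst nn_integral_eq_integral) (auto simp: has_bochner_integral_iff)
  finally have "finite_measure (density \<kappa> (kolmogorov_density \<beta>))"
    by (intro finite_measureI) simp
  then show "finite_measure (kolmogorov_measure \<beta>)"
    unfolding kolmogorov_measure_def by (intro finite_measure.finite_measure_distr) measurable
  show "sets (kolmogorov_measure \<beta>) = sets borel" by (simp add: kolmogorov_measure_def)
  have "AE x in density \<kappa> (kolmogorov_density \<beta>). 0 < exp (- (\<beta> * x)) \<and> exp (- (\<beta> * x)) < 1"
    by (subst AE_density) (use AE_\<kappa> \<beta> in \<open>auto elim!: eventually_mono\<close>)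
  then show "AE w in kolmogorov_measure \<beta>. 0 < w \<and> w < 1"
    unfolding kolmogorov_measure_def by (subst AE_distr_iff) auto
qed

lemma integral_kolmogorov_measure:
  assumes \<beta>: "0 < \<beta>" and [measurable]: "g \<in> borel_measurable borel"
  shows "integrable (kolmogorov_measure \<beta>) g \<longleftrightarrow>
      integrable \<kappa> (\<lambda>x. kolmogorov_density \<beta> x *\<^sub>R (g (exp (- (\<beta> * x))) :: complex))"
    and "integral\<^sup>L (kolmogorov_measure \<beta>) g = (\<integral>x. kolmogorov_density \<beta> x *\<^sub>R g (exp (- (\<beta> * x))) \<partial>\<kappa>)"
proof -
  show "integrable (kolmogorov_measure \<beta>) g \<longleftrightarrow>
      integrable \<kappa> (\<lambda>x. kolmogorov_density \<beta> x *\<^sub>R (g (exp (- (\<beta> * x)))))"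
    unfolding kolmogorov_measure_def
    by (subst integrable_distr_eq, measurable, subst integrable_density)
       (use AE_kolmogorov_density[OF \<beta>] in auto)
  show "integral\<^sup>L (kolmogorov_measure \<beta>) g = (\<integral>x. kolmogorov_density \<beta> x *\<^sub>R g (exp (- (\<beta> * x))) \<partial>\<kappa>)"
    unfolding kolmogorov_measure_def
    by (subst integral_distr, measurable, subst integral_density)
       (use AE_kolmogorov_density[OF \<beta>] in auto)
qed

lemma mellin_integrand_measurable [measurable]: "mellin_integrand \<alpha> \<beta> z \<in> borel_measurable borel"
  unfolding mellin_integrand_def by measurable

lemma AE_mellin_integrand_eq:
  assumes \<beta>: "0 < \<beta>"
  shows "AE x in \<kappa>. kolmogorov_density \<beta> x *\<^sub>R levy_kernel z (exp (- (\<beta> * x))) = - mellin_integrand \<alpha> \<beta> z x"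
  using AE_\<kappa>
proof eventually_elim
  case (elim x)
  define w where "w = exp (- (\<beta> * x))"
  have w: "0 < w" "w < 1" using elim \<beta> by (auto simp: w_def)
  have wz: "complex_of_real w powr z = exp (- z * of_real (\<beta> * x))"
    using w by (simp add: complex_powr_of_pos_real w_def)
  have d: "kolmogorov_density \<beta> x = exp (- (\<alpha> * x)) * (1 - w) / x"
    by (simp add: kolmogorov_density_def w_def algebra_simps flip: exp_add)
  have w1: "1 - complex_of_real w \<noteq> 0" using w by (metis eq_iff_diff_eq_0 of_real_1 of_real_eq_iff order_less_irrefl)
  have "mellin_integrand \<alpha> \<beta> z x = ((1 - complex_of_real w powr z) - z * (1 - of_real w))
      * (of_real (exp (- (\<alpha> * x))) / (of_real x * (1 - of_real w)))"
    unfolding mellin_integrand_def wz by (simp add: w_def)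
  moreover have "kolmogorov_density \<beta> x *\<^sub>R levy_kernel z w
      = of_real (exp (- (\<alpha> * x))) * (1 - of_real w) / of_real x
        * ((of_real w powr z - 1 + z * (1 - of_real w)) / (1 - of_real w)\<^sup>2)"
    by (simp add: d levy_kernel_def scaleR_conv_of_real)
  moreover have "A * D / X * ((B - 1 + z * D) / D\<^sup>2) = - (((1 - B) - z * D) * (A / (X * D)))"
    if "D \<noteq> 0" "X \<noteq> 0" for A B D X :: complex
    using that by (simp add: divide_simps) (simp add: power2_eq_square algebra_simps)
  ultimately show ?case
    using w1 elim by (simp only: w_def[symmetric] of_real_eq_0_iff not_False_eq_True)
qed

lemma mellin_exponent_eq:
  assumes \<beta>: "0 < \<beta>" and z: "0 \<le> Re z"
  shows "integrable \<kappa> (mellin_integrand \<alpha> \<beta> z)"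
    and "levy_data.exponent (kolmogorov_measure \<beta>) (ln (f \<alpha>)) z = - mellin_exponent f \<alpha> \<beta> \<kappa> z"
proof -
  interpret D: levy_data "kolmogorov_measure \<beta>" "ln (f \<alpha>)"
    by (rule levy_data_kolmogorov_measure[OF \<beta>])
  have "integrable \<kappa> (\<lambda>x. kolmogorov_density \<beta> x *\<^sub>R levy_kernel z (exp (- (\<beta> * x))))"
    using D.integrable_levy_kernel[OF z] by (subst (asm) integral_kolmogorov_measure[OF \<beta>]) auto
  then have "integrable \<kappa> (\<lambda>x. - mellin_integrand \<alpha> \<beta> z x)"
    by (rule integrable_cong_AE[THEN iffD1, rotated -1]) (use AE_mellin_integrand_eq[OF \<beta>] in auto)
  then show int: "integrable \<kappa> (mellin_integrand \<alpha> \<beta> z)" by simp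
  have "(\<integral>w. levy_kernel z w \<partial>kolmogorov_measure \<beta>)
      = (\<integral>x. kolmogorov_density \<beta> x *\<^sub>R levy_kernel z (exp (- (\<beta> * x))) \<partial>\<kappa>)"
    by (rule integral_kolmogorov_measure[OF \<beta>]) measurable
  also have "\<dots> = (\<integral>x. - mellin_integrand \<alpha> \<beta> z x \<partial>\<kappa>)"
    by (rule integral_cong_AE) (use AE_mellin_integrand_eq[OF \<beta>] in auto)
  also have "\<dots> = - (\<integral>x. mellin_integrand \<alpha> \<beta> z x \<partial>\<kappa>)" by simp
  finally show "D.exponent z = - mellin_exponent f \<alpha> \<beta> \<kappa> z"
    by (simp add: D.exponent_def mellin_exponent_def)
qed

text \<open>At \<open>z = n\<close> the numerator of the kernel is \<open>(1 - w) (\<Sum>\<^sub>k\<^sub><\<^sub>n 1 - w\<^sup>k)\<close>. Together with the density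
  this leaves \<open>\<Sum>\<^sub>k\<^sub><\<^sub>n (e\<^sup>-\<^sup>\<alpha>\<^sup>x - e\<^sup>-\<^sup>(\<^sup>\<alpha>\<^sup>+\<^sup>k\<^sup>\<beta>\<^sup>)\<^sup>x) / x\<close>, whose integrals are increments of \<open>log f\<close>.\<close>

lemma exponent_of_nat:
  assumes \<beta>: "0 < \<beta>"
  shows "levy_data.exponent (kolmogorov_measure \<beta>) (ln (f \<alpha>)) (of_nat n)
    = of_real (\<Sum>k<n. ln (f (\<alpha> + real k * \<beta>)))"
proof -
  interpret D: levy_data "kolmogorov_measure \<beta>" "ln (f \<alpha>)"
    by (rule levy_data_kolmogorov_measure[OF \<beta>])
  have pt: "kolmogorov_density \<beta> x *\<^sub>R levy_kernel (of_nat n) (exp (- (\<beta> * x)))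
      = of_real (\<Sum>k<n. (exp (- (\<alpha> * x)) - exp (- ((\<alpha> + real k * \<beta>) * x))) / x)" if x: "0 < x" for x
  proof -
    define w where "w = exp (- (\<beta> * x))"
    have w: "0 < w" "w < 1" using x \<beta> by (auto simp: w_def)
    have wk: "exp (- ((\<alpha> + real k * \<beta>) * x)) = exp (- (\<alpha> * x)) * w ^ k" for k
      by (simp add: w_def algebra_simps flip: exp_add exp_of_nat_mult)
    have d: "kolmogorov_density \<beta> x = exp (- (\<alpha> * x)) * (1 - w) / x"
      by (simp add: kolmogorov_density_def w_def algebra_simps flip: exp_add)
    have s: "w ^ n - 1 + real n * (1 - w) = (1 - w) * (\<Sum>k<n. 1 - w ^ k)"
      using one_diff_power_eq[of w n] by (simp add: sum_subtractf algebra_simps)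
    have "levy_kernel (of_nat n) w = of_real ((w ^ n - 1 + real n * (1 - w)) / (1 - w)\<^sup>2)"
      using w by (simp add: levy_kernel_def powr_nat')
    also have "(w ^ n - 1 + real n * (1 - w)) / (1 - w)\<^sup>2 = (\<Sum>k<n. 1 - w ^ k) / (1 - w)"
      unfolding s using w by (simp add: power2_eq_square)
    finally have "kolmogorov_density \<beta> x *\<^sub>R levy_kernel (of_nat n) w
        = of_real (exp (- (\<alpha> * x)) * (1 - w) / x * ((\<Sum>k<n. 1 - w ^ k) / (1 - w)))"
      by (simp only: d scaleR_conv_of_real of_real_mult)
    also have "exp (- (\<alpha> * x)) * (1 - w) / x * ((\<Sum>k<n. 1 - w ^ k) / (1 - w))
        = exp (- (\<alpha> * x)) / x * (\<Sum>k<n. 1 - w ^ k)"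
      using w x by simp
    also have "\<dots> = (\<Sum>k<n. (exp (- (\<alpha> * x)) - exp (- ((\<alpha> + real k * \<beta>) * x))) / x)"
      unfolding wk sum_distrib_left by (intro sum.cong refl) (simp add: field_simps)
    finally show ?thesis by (simp only: w_def)
  qed
  have hb: "has_bochner_integral \<kappa> (\<lambda>x. \<Sum>k<n. (exp (- (\<alpha> * x)) - exp (- ((\<alpha> + real k * \<beta>) * x))) / x)
      (\<Sum>k<n. ln (f (\<alpha> + real k * \<beta>)) - ln (f \<alpha>))"
    by (intro has_bochner_integral_sum log_increment) (use \<beta> in auto)
  have "(\<integral>w. levy_kernel (of_nat n) w \<partial>kolmogorov_measure \<beta>)
      = (\<integral>x. kolmogorov_density \<beta> x *\<^sub>R levy_kernel (of_nat n) (exp (- (\<beta> * x))) \<partial>\<kappa>)"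
    by (rule integral_kolmogorov_measure[OF \<beta>]) measurable
  also have "\<dots> = (\<integral>x. complex_of_real (\<Sum>k<n. (exp (- (\<alpha> * x)) - exp (- ((\<alpha> + real k * \<beta>) * x))) / x) \<partial>\<kappa>)"
  proof (rule integral_cong_AE)
    show "AE x in \<kappa>. kolmogorov_density \<beta> x *\<^sub>R levy_kernel (of_nat n) (exp (- (\<beta> * x)))
        = complex_of_real (\<Sum>k<n. (exp (- (\<alpha> * x)) - exp (- ((\<alpha> + real k * \<beta>) * x))) / x)"
      using AE_\<kappa> by eventually_elim (rule pt)
  qed measurable
  also have "\<dots> = of_real (\<Sum>k<n. ln (f (\<alpha> + real k * \<beta>)) - ln (f \<alpha>))"
    using hb by (simp only: integral_complex_of_real has_bochner_integral_iff)
  finally show ?thesis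
    by (simp add: D.exponent_def sum_subtractf)
qed

end

section \<open>Product convolution semigroups\<close>

lemma set_lebesgue_integral_distr_ln:
  fixes g :: "real \<Rightarrow> real"
  assumes p: "prob_on {0<..} \<mu>" and g: "continuous_on {0<..} g"
  shows "(LINT x:{0<..}|\<mu>. g x) = (\<integral>y. g (exp y) \<partial>distr \<mu> borel ln)"
proof -
  have [measurable_cong]: "sets \<mu> = sets borel" using p by (simp add: prob_on_pos_iff)
  have ge: "continuous_on UNIV (\<lambda>y. g (exp y))"
    by (rule continuous_on_compose2[OF g]) (auto intro!: continuous_intros)
  then have [measurable]: "(\<lambda>y. g (exp y)) \<in> borel_measurable borel" by (rule borel_measurable_continuous_onI)
  have [measurable]: "(\<lambda>x. indicator {0<..} x *\<^sub>R g x) \<in> borel_measurable borel"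
    by (rule borel_measurable_continuous_on_indicator[OF _ g]) auto
  have "(\<integral>y. g (exp y) \<partial>distr \<mu> borel ln) = (\<integral>x. g (exp (ln x)) \<partial>\<mu>)"
    by (rule integral_distr) measurable
  also have "\<dots> = (\<integral>x. indicator {0<..} x *\<^sub>R g x \<partial>\<mu>)"
  proof (rule integral_cong_AE)
    show "(\<lambda>x. g (exp (ln x))) \<in> borel_measurable \<mu>"
      by (rule measurable_compose[where g = "\<lambda>y. g (exp y)" and f = ln]) measurable
    show "AE x in \<mu>. g (exp (ln x)) = indicator {0<..} x *\<^sub>R g x"
      using p by (auto simp: prob_on_pos_iff elim!: eventually_mono)
  qed measurable
  finally show ?thesis by (simp add: set_lebesgue_integral_def)
qed

text \<open>The transforms satisfy the semigroup law and determine the measures. The characteristic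
  functions of the logarithms depend continuously on \<open>c\<close>, so Levy's continuity theorem gives weak
  continuity.\<close>

lemma prod_convolution_semigroup_if_mellin:
  assumes m: "\<And>c. 0 < c \<Longrightarrow> has_mellin (\<sigma> c) (\<lambda>z. exp (of_real c * E z))"
  shows "prod_convolution_semigroup \<sigma>"
  unfolding prod_convolution_semigroup_def
proof (intro conjI allI impI)
  have p: "prob_on {0<..} (\<sigma> c)" if "0 < c" for c using m[OF that] by (simp add: has_mellin_def)
  then show "prob_on {0<..} (\<sigma> c)" if "0 < c" for c using that .
  show "prod_convolution (\<sigma> c) (\<sigma> d) = \<sigma> (c + d)" if "0 < c" "0 < d" for c d
  proof (rule has_mellin_unique)
    show "has_mellin (prod_convolution (\<sigma> c) (\<sigma> d)) (\<lambda>z. exp (of_real (c + d) * E z))"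
      by (rule has_mellin_cong[OF has_mellin_prod_convolution[OF m[OF that(1)] m[OF that(2)]]])
         (simp add: distrib_right exp_add)
    show "has_mellin (\<sigma> (c + d)) (\<lambda>z. exp (of_real (c + d) * E z))" using that by (intro m) simp
  qed
  fix g :: "real \<Rightarrow> real" assume g: "continuous_on {0<..} g \<and> bounded (g ` {0<..})"
  then obtain B where B: "\<And>x. 0 < x \<Longrightarrow> norm (g x) \<le> B" by (auto simp: bounded_iff)
  show "continuous_on {0<..} (\<lambda>c. LINT x:{0<..}|\<sigma> c. g x)"
    unfolding continuous_on_sequentially
  proof (intro allI ballI impI)
    fix C :: "nat \<Rightarrow> real" and c assume c: "c \<in> {0<..}" and C: "(\<forall>n. C n \<in> {0<..}) \<and> C \<longlonglongrightarrow> c"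
    then have c0: "0 < c" and C0: "0 < C n" for n by auto
    have rd: "real_distribution (distr (\<sigma> (C n)) borel ln)" "real_distribution (distr (\<sigma> c) borel ln)" for n
      using p[OF C0] p[OF c0] by (auto intro: real_distribution_distr_ln)
    have "weak_conv_m (\<lambda>n. distr (\<sigma> (C n)) borel ln) (distr (\<sigma> c) borel ln)"
    proof (rule levy_continuity[OF rd])
      show "(\<lambda>n. char (distr (\<sigma> (C n)) borel ln) t) \<longlonglongrightarrow> char (distr (\<sigma> c) borel ln) t" for t
        unfolding char_distr_ln[OF m[OF C0]] char_distr_ln[OF m[OF c0]]
        using C by (intro tendsto_intros) auto
    qed
    then have "(\<lambda>n. \<integral>y. g (exp y) \<partial>distr (\<sigma> (C n)) borel ln) \<longlonglongrightarrow> (\<integral>y. g (exp y) \<partial>distr (\<sigma> c) borel ln)"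
    proof (rule weak_conv_imp_integral_bdd_continuous_conv[OF rd])
      have "continuous_on UNIV (\<lambda>y. g (exp y))"
        by (rule continuous_on_compose2[of "{0<..}" g]) (use g in \<open>auto intro!: continuous_intros\<close>)
      then show "isCont (\<lambda>y. g (exp y)) x" for x by (simp add: continuous_on_eq_continuous_at)
      show "norm (g (exp y)) \<le> B" for y by (rule B) simp
    qed
    then show "((\<lambda>c. LINT x:{0<..}|\<sigma> c. g x) \<circ> C) \<longlonglongrightarrow> (LINT x:{0<..}|\<sigma> c. g x)"
      using g p c0 C0 by (simp add: o_def set_lebesgue_integral_distr_ln)
  qed
qed

lemma prod_convolution_return_1:
  assumes p: "prob_on {0<..} \<mu>"
  shows "prod_convolution \<mu> (return borel 1) = \<mu>"
proof (rule measure_eqI)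
  have s [measurable_cong]: "sets \<mu> = sets borel" using p by (simp add: prob_on_pos_iff)
  interpret prob_space \<mu> using p by (simp add: prob_on_pos_iff)
  interpret R: prob_space "return borel (1::real)" by (simp add: prob_space_return)
  have [measurable_cong]: "sets (return borel (1::real)) = sets borel" by simp
  show "sets (prod_convolution \<mu> (return borel 1)) = sets \<mu>"
    by (simp add: prod_convolution_def s)
  fix A assume "A \<in> sets (prod_convolution \<mu> (return borel 1))"
  then have A [measurable]: "A \<in> sets borel" by (simp add: prod_convolution_def)
  have "emeasure (prod_convolution \<mu> (return borel 1)) A
      = (\<integral>\<^sup>+x. indicator A x \<partial>prod_convolution \<mu> (return borel 1))"
    by (simp add: prod_convolution_def)
  also have "\<dots> = (\<integral>\<^sup>+p. indicator A (fst p * snd p) \<partial>(\<mu> \<Otimes>\<^sub>M return borel 1))"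
    unfolding prod_convolution_def by (subst nn_integral_distr) (auto simp: case_prod_beta)
  also have "\<dots> = (\<integral>\<^sup>+x. \<integral>\<^sup>+y. indicator A (x * y) \<partial>return borel 1 \<partial>\<mu>)"
    by (subst R.nn_integral_fst[symmetric]) auto
  also have "\<dots> = (\<integral>\<^sup>+x. indicator A x \<partial>\<mu>)" by (simp add: nn_integral_return)
  also have "\<dots> = emeasure \<mu> A" using A s by simp
  finally show "emeasure (prod_convolution \<mu> (return borel 1)) A = emeasure \<mu> A" .
qed

lemma prod_convolution_semigroup_power:
  assumes \<sigma>: "prod_convolution_semigroup \<sigma>" and c: "0 < c"
  shows "prod_convolution_power (\<sigma> c) (Suc n) = \<sigma> (real (Suc n) * c)"
proof (induction n)
  case 0
  have "prob_on {0<..} (\<sigma> c)" using assms by (simp add: prod_convolution_semigroup_def)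
  then show ?case by (simp add: prod_convolution_return_1)
next
  case (Suc n)
  have "prod_convolution_power (\<sigma> c) (Suc (Suc n)) = prod_convolution (\<sigma> c) (\<sigma> (real (Suc n) * c))"
    using Suc by simp
  also have "\<dots> = \<sigma> (c + real (Suc n) * c)"
    using assms unfolding prod_convolution_semigroup_def by (metis mult_pos_pos of_nat_0_less_iff zero_less_Suc)
  finally show ?case by (simp add: algebra_simps)
qed

text \<open>Agreement at the times \<open>1/p\<close> extends to rational times by taking convolution powers. Weak
  continuity, tested on \<open>cos (u log x)\<close> and \<open>sin (u log x)\<close>, extends it to all times.\<close>

lemma prod_convolution_semigroup_eqI:
  assumes s: "prod_convolution_semigroup \<sigma>" "prod_convolution_semigroup \<sigma>'"
    and roots: "\<And>p. \<sigma>' (1 / real (Suc p)) = \<sigma> (1 / real (Suc p))" and c: "0 < c"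
  shows "\<sigma>' c = \<sigma> c"
proof -
  have rat: "\<sigma>' q = \<sigma> q" if q: "q \<in> \<rat>" "0 < q" for q
  proof -
    obtain i :: int and n :: nat where i: "q = of_int i / of_nat n" "n \<noteq> 0"
      using q(1) unfolding Rats_eq_int_div_nat by auto
    with q(2) have "0 < i" by (simp add: zero_less_divide_iff)
    then obtain m where m: "i = int (Suc m)" by (metis Suc_pred' pos_int_cases)
    obtain p where p: "n = Suc p" using i(2) by (cases n) auto
    have "q = real (Suc m) * (1 / real (Suc p))" using i m p by simp
    then show ?thesis
      using prod_convolution_semigroup_power[OF s(1), of "1 / real (Suc p)" m]
        prod_convolution_semigroup_power[OF s(2), of "1 / real (Suc p)" m] roots[of p] by simp
  qed
  have "\<exists>q\<in>\<rat>. c < q \<and> q < c + inverse (real (Suc n))" for n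
    by (rule Rats_dense_in_real) simp
  then obtain Q where Q: "\<And>n. Q n \<in> \<rat>" "\<And>n. c < Q n" "\<And>n. Q n < c + inverse (real (Suc n))"
    by metis
  have Q0: "0 < Q n" for n using c Q(2)[of n] by linarith
  have Qlim: "Q \<longlonglongrightarrow> c"
  proof (rule tendsto_sandwich[of "\<lambda>_. c" Q sequentially "\<lambda>n. c + inverse (real (Suc n))"])
    show "(\<lambda>n. c + inverse (real (Suc n))) \<longlonglongrightarrow> c"
      using tendsto_add[OF tendsto_const[of c] LIMSEQ_inverse_real_of_nat] by simp
  qed (use Q in \<open>auto intro!: always_eventually less_imp_le\<close>)
  have p: "prob_on {0<..} (\<sigma> c)" "prob_on {0<..} (\<sigma>' c)"
    using s c by (auto simp: prod_convolution_semigroup_def)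
  have int: "(\<integral>y. g (exp y) \<partial>distr (\<sigma>' c) borel ln) = (\<integral>y. g (exp y) \<partial>distr (\<sigma> c) borel ln)"
    if g: "continuous_on {0<..} g" "bounded (g ` {0<..})" for g :: "real \<Rightarrow> real"
  proof -
    have lim: "(\<lambda>n. LINT x:{0<..}|\<rho> (Q n). g x) \<longlonglongrightarrow> (LINT x:{0<..}|\<rho> c. g x)"
      if "prod_convolution_semigroup \<rho>" for \<rho>
    proof -
      have "continuous_on {0<..} (\<lambda>c. LINT x:{0<..}|\<rho> c. g x)"
        using that g by (simp add: prod_convolution_semigroup_def)
      from continuous_on_tendsto_compose[OF this Qlim] c Q0 show ?thesis by auto
    qed
    have "(LINT x:{0<..}|\<sigma>' c. g x) = (LINT x:{0<..}|\<sigma> c. g x)"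
      by (rule LIMSEQ_unique[OF lim[OF s(2)]]) (use lim[OF s(1)] rat[OF Q(1) Q0] in simp)
    then show ?thesis using p g by (simp add: set_lebesgue_integral_distr_ln)
  qed
  have "char (distr (\<sigma>' c) borel ln) t = char (distr (\<sigma> c) borel ln) t" for t
  proof -
    have re: "Re (char (distr \<mu> borel ln) t) = (\<integral>y. cos (t * ln (exp y)) \<partial>distr \<mu> borel ln)"
      and im: "Im (char (distr \<mu> borel ln) t) = (\<integral>y. sin (t * ln (exp y)) \<partial>distr \<mu> borel ln)"
      if "prob_on {0<..} \<mu>" for \<mu>
    proof -
      interpret D: real_distribution "distr \<mu> borel ln" by (rule real_distribution_distr_ln[OF that])
      have i: "integrable (distr \<mu> borel ln) (\<lambda>y. iexp (t * y))"
        by (rule D.integrable_const_bound[where B = 1]) auto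
      show "Re (char (distr \<mu> borel ln) t) = (\<integral>y. cos (t * ln (exp y)) \<partial>distr \<mu> borel ln)"
        unfolding char_def using integral_Re[OF i] by (simp add: Re_exp)
      show "Im (char (distr \<mu> borel ln) t) = (\<integral>y. sin (t * ln (exp y)) \<partial>distr \<mu> borel ln)"
        unfolding char_def using integral_Im[OF i] by (simp add: Im_exp)
    qed
    have "(\<integral>y. cos (t * ln (exp y)) \<partial>distr (\<sigma>' c) borel ln) = (\<integral>y. cos (t * ln (exp y)) \<partial>distr (\<sigma> c) borel ln)"
      by (rule int[where g = "\<lambda>x. cos (t * ln x)"])
         (auto intro!: continuous_intros boundedI[where B = 1])
    moreover have "(\<integral>y. sin (t * ln (exp y)) \<partial>distr (\<sigma>' c) borel ln) = (\<integral>y. sin (t * ln (exp y)) \<partial>distr (\<sigma> c) borel ln)"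
      by (rule int[where g = "\<lambda>x. sin (t * ln x)"])
         (auto intro!: continuous_intros boundedI[where B = 1])
    ultimately show ?thesis using re im p by (simp add: complex_eq_iff)
  qed
  then have "distr (\<sigma>' c) borel ln = distr (\<sigma> c) borel ln"
    by (intro Levy_uniqueness real_distribution_distr_ln p ext)
  then show ?thesis using distr_exp_distr_ln[OF p(1)] distr_exp_distr_ln[OF p(2)] by metis
qed

lemma prod_infinitely_divisible_semigroup_1:
  assumes \<sigma>: "prod_convolution_semigroup \<sigma>"
  shows "prod_infinitely_divisible (\<sigma> 1)"
  unfolding prod_infinitely_divisible_def
proof (intro conjI allI impI)
  show "prob_on {0<..} (\<sigma> 1)" using \<sigma> by (simp add: prod_convolution_semigroup_def)
  fix p :: nat assume "1 \<le> p"
  then obtain n where p: "p = Suc n" by (cases p) auto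
  have "prod_convolution_power (\<sigma> (1 / real p)) p = \<sigma> 1"
    using prod_convolution_semigroup_power[OF \<sigma>, of "1 / real p" n] p by simp
  moreover have "prob_on {0<..} (\<sigma> (1 / real p))"
    using \<sigma> p by (simp add: prod_convolution_semigroup_def)
  ultimately show "\<exists>\<tau>. prob_on {0<..} \<tau> \<and> prod_convolution_power \<tau> p = \<sigma> 1" by blast
qed

text \<open>The moments of a \<open>p\<close>-fold convolution are the \<open>p\<close>-th powers of the moments, in \<open>[0,\<infinity>]\<close>; so the
  moments of the root are finite.\<close>

lemma has_moments_convolution_root:
  assumes \<tau>: "prob_on {0<..} \<tau>" and m: "has_moments (prod_convolution_power \<tau> (Suc p)) s"
    and s: "\<And>n. 1 \<le> n \<Longrightarrow> 0 < s n"
  shows "has_moments \<tau> (\<lambda>n. s n powr (1 / real (Suc p)))"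
  unfolding has_moments_def
proof (intro allI impI)
  fix n :: nat assume n: "1 \<le> n"
  have [measurable_cong]: "sets \<tau> = sets borel" and ae: "AE x in \<tau>. 0 < x"
    using \<tau> by (auto simp: prob_on_pos_iff)
  define I where "I = (\<integral>\<^sup>+x. ennreal (x ^ n) \<partial>\<tau>)"
  have "I ^ Suc p = (\<integral>\<^sup>+x. ennreal (x ^ n) \<partial>prod_convolution_power \<tau> (Suc p))"
    unfolding I_def by (rule nn_moment_prod_convolution_power[OF \<tau>, symmetric])
  also have "\<dots> = ennreal (\<integral>x. x ^ n \<partial>prod_convolution_power \<tau> (Suc p))"
  proof (rule nn_integral_eq_integral)
    show "integrable (prod_convolution_power \<tau> (Suc p)) (\<lambda>x. x ^ n)"
      using m n unfolding has_moments_def has_bochner_integral_iff by blast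
    have "AE x in prod_convolution_power \<tau> (Suc p). 0 < x"
      using prob_on_prod_convolution_power[OF \<tau>, of "Suc p"] unfolding prob_on_pos_iff by blast
    then show "AE x in prod_convolution_power \<tau> (Suc p). 0 \<le> x ^ n"
      by eventually_elim simp
  qed
  also have "(\<integral>x. x ^ n \<partial>prod_convolution_power \<tau> (Suc p)) = s n"
    using m n unfolding has_moments_def has_bochner_integral_iff by blast
  finally have I: "I ^ Suc p = ennreal (s n)" .
  have "I \<noteq> \<top>"
  proof
    assume "I = \<top>"
    then have "I ^ Suc p = \<top>" by (simp add: top_power_ennreal)
    with I show False by simp
  qed
  then obtain r where r: "0 \<le> r" "I = ennreal r" by (cases I) auto
  from I r have rp: "r ^ Suc p = s n" using s[OF n] by (simp add: ennreal_power less_imp_le del: power_Suc)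
  have "r \<noteq> 0" using rp s[OF n] by auto
  then have r0: "0 < r" using r by simp
  have "r = r powr (real (Suc p) * (1 / real (Suc p)))" using r0 by simp
  also have "\<dots> = s n powr (1 / real (Suc p))"
    using r0 by (simp only: powr_powr[symmetric] powr_realpow rp)
  finally have req: "r = s n powr (1 / real (Suc p))" .
  have "has_bochner_integral \<tau> (\<lambda>x. x ^ n) r"
    by (rule has_bochner_integral_nn_integral)
       (use r ae in \<open>auto simp: I_def elim!: eventually_mono\<close>)
  then show "has_bochner_integral \<tau> (\<lambda>x. x ^ n) (s n powr (1 / real (Suc p)))" by (simp only: req)
qed

section \<open>Bernstein moments and their semigroup\<close>

text \<open>By linear growth \<open>f(\<alpha> + k \<beta>) \<le> K (k + 1)\<close>. With \<open>K \<ge> 1\<close> the bound is itself at least 1, so it also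
  holds for the powers of the product with exponents in \<open>]0,1]\<close>.\<close>

lemma (in bernstein_representation) prod_values_le:
  assumes \<alpha>: "0 \<le> \<alpha>" and f\<alpha>: "0 < f \<alpha>" and \<beta>: "0 < \<beta>"
  shows "\<exists>K\<ge>1. \<forall>n. (\<Prod>k<n. f (\<alpha> + real k * \<beta>)) \<le> K ^ n * fact n"
proof -
  obtain C where C: "0 < C" "\<And>s. 0 \<le> s \<Longrightarrow> f s \<le> C * (1 + s)" using linear_bound by blast
  define K where "K = max 1 (C * (1 + \<alpha> + \<beta>))"
  have val: "f (\<alpha> + real k * \<beta>) \<le> K * real (Suc k)" for k
  proof -
    have "f (\<alpha> + real k * \<beta>) \<le> C * (1 + (\<alpha> + real k * \<beta>))" by (rule C) (use \<alpha> \<beta> in simp)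
    also have "\<dots> \<le> C * ((1 + \<alpha> + \<beta>) * real (Suc k))"
      using C \<alpha> \<beta> by (intro mult_left_mono) (auto simp: algebra_simps)
    also have "\<dots> \<le> K * real (Suc k)"
      unfolding mult.assoc[symmetric] by (intro mult_right_mono) (auto simp: K_def)
    finally show ?thesis .
  qed
  have "(\<Prod>k<n. f (\<alpha> + real k * \<beta>)) \<le> (\<Prod>k<n. K * real (Suc k))" for n
  proof (rule prod_mono)
    fix k
    have "f \<alpha> \<le> f (\<alpha> + real k * \<beta>)" by (rule mono_f) (use \<alpha> \<beta> in auto)
    then show "0 \<le> f (\<alpha> + real k * \<beta>) \<and> f (\<alpha> + real k * \<beta>) \<le> K * real (Suc k)"
      using val f\<alpha> by auto
  qed
  moreover have "(\<Prod>k<n. K * real (Suc k)) = K ^ n * fact n" for n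
    by (induction n) (auto simp: algebra_simps)
  ultimately show ?thesis by (intro exI[of _ K]) (auto simp: K_def)
qed

theorem theorem1p2:
  fixes \<alpha> \<beta> :: real and f :: "real \<Rightarrow> real" and \<kappa> :: "real measure"
  assumes "\<alpha> \<ge> 0" and "\<beta> > 0"
    and "f \<in> nonzero_bernstein_functions" and "f \<alpha> > 0"
    and "borel_measure_on {0..} \<kappa>"
    and "\<And>s. s > 0 \<Longrightarrow> has_bochner_integral \<kappa> (\<lambda>x. exp (- (s * x))) (deriv f s / f s)"
  shows "(\<exists>!\<rho>. prob_on {0..} \<rho> \<and> has_moments \<rho> (\<lambda>n. \<Prod>k<n. f (\<alpha> + real k * \<beta>))) \<and>
    (\<forall>\<rho>. prob_on {0..} \<rho> \<and> has_moments \<rho> (\<lambda>n. \<Prod>k<n. f (\<alpha> + real k * \<beta>)) \<longrightarrow>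
      borel_measure_on {0<..} \<rho> \<and>
      prod_infinitely_divisible \<rho> \<and>
      (\<exists>\<sigma>. prod_convolution_semigroup \<sigma> \<and> \<sigma> 1 = \<rho> \<and>
        (\<forall>\<sigma>'. prod_convolution_semigroup \<sigma>' \<and> \<sigma>' 1 = \<rho> \<longrightarrow> (\<forall>c>0. \<sigma>' c = \<sigma> c)) \<and>
        (\<forall>c>0. has_moments (\<sigma> c) (\<lambda>n. (\<Prod>k<n. f (\<alpha> + real k * \<beta>)) powr c)) \<and>
        (\<forall>z. Re z \<ge> 0 \<longrightarrow>
          integrable \<kappa> (mellin_integrand \<alpha> \<beta> z) \<and>
          (\<forall>c>0. has_bochner_integral (\<sigma> c) (\<lambda>t. complex_of_real t powr z)
            (exp (- of_real c * mellin_exponent f \<alpha> \<beta> \<kappa> z))))))"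
proof -
  note \<beta> = \<open>\<beta> > 0\<close>
  obtain a b \<nu> where "bernstein_representation f a b \<nu>"
    using assms(3) bernstein_function_representation
    unfolding nonzero_bernstein_functions_def by blast
  then interpret B: bernstein_log_derivative f a b \<nu> \<alpha> \<kappa>
    using assms unfolding bernstein_log_derivative_def bernstein_log_derivative_axioms_def
    by (auto simp: borel_measure_on_iff_AE)
  interpret D: levy_data "B.kolmogorov_measure \<beta>" "ln (f \<alpha>)"
    by (rule B.levy_data_kolmogorov_measure[OF \<beta>])
  define s where "s n = (\<Prod>k<n. f (\<alpha> + real k * \<beta>))" for n
  have fpos: "0 < f (\<alpha> + real k * \<beta>)" for k
    using B.mono_f[of \<alpha> "\<alpha> + real k * \<beta>"] assms(1,4) \<beta> by auto
  have spos: "0 < s n" for n unfolding s_def by (intro prod_pos ballI fpos)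
  obtain K where K: "1 \<le> K" "\<And>n. s n \<le> K ^ n * fact n"
    using B.prod_values_le[OF assms(1,4) \<beta>] unfolding s_def by blast
  define E where "E z = - mellin_exponent f \<alpha> \<beta> \<kappa> z" for z
  obtain \<sigma> where \<sigma>: "\<And>c. 0 < c \<Longrightarrow> has_mellin (\<sigma> c) (\<lambda>z. exp (of_real c * E z))"
  proof -
    have "\<exists>\<mu>. has_mellin \<mu> (\<lambda>z. exp (of_real c * E z))" if c: "0 < c" for c
    proof -
      obtain \<mu> where "has_mellin \<mu> (\<lambda>z. exp (of_real c * D.exponent z))" using D.exists_mellin[OF c] by blast
      then have "has_mellin \<mu> (\<lambda>z. exp (of_real c * E z))"
        by (rule has_mellin_cong) (simp add: E_def B.mellin_exponent_eq(2)[OF \<beta>])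
      then show ?thesis by blast
    qed
    then show thesis using that by metis
  qed
  have E_nat: "exp (of_real c * E (of_nat n)) = of_real (s n powr c)" for c n
  proof -
    have "E (of_nat n) = of_real (\<Sum>k<n. ln (f (\<alpha> + real k * \<beta>)))"
      using B.exponent_of_nat[OF \<beta>, of n] B.mellin_exponent_eq(2)[OF \<beta>, of "of_nat n"] by (simp add: E_def)
    also have "(\<Sum>k<n. ln (f (\<alpha> + real k * \<beta>))) = ln (s n)"
      unfolding s_def by (rule ln_prod[symmetric]) (simp, metis fpos less_irrefl)
    finally have "E (of_nat n) = of_real (ln (s n))" .
    then have "exp (of_real c * E (of_nat n)) = exp (complex_of_real (c * ln (s n)))" by simp
    also have "\<dots> = of_real (s n powr c)"
      using spos[of n] by (simp only: exp_of_real powr_def) simp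
    finally show ?thesis .
  qed
  have semi: "prod_convolution_semigroup \<sigma>" by (rule prod_convolution_semigroup_if_mellin[OF \<sigma>])
  have pos: "prob_on {0<..} (\<sigma> c)" if "0 < c" for c using \<sigma>[OF that] by (simp add: has_mellin_def)
  have weaken: "prob_on {0..} \<mu>" if "prob_on {0<..} \<mu>" for \<mu>
    using that by (auto simp: prob_on_def borel_measure_on_iff_AE elim!: eventually_mono)
  have mom: "has_moments (\<sigma> c) (\<lambda>n. s n powr c)" if "0 < c" for c
    by (rule has_mellin_moments[OF \<sigma>[OF that]]) (rule E_nat)
  have mom1: "has_moments (\<sigma> 1) s" using mom[of 1] spos by (simp add: less_imp_le)
  have uniq: "\<rho> = \<sigma> 1" if "prob_on {0..} \<rho>" "has_moments \<rho> s" for \<rho>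
    by (rule stieltjes_moment_determinacy[OF that(1) weaken[OF pos] that(2) mom1, of K])
       (use K in auto)
  have semi_uniq: "\<sigma>' c = \<sigma> c" if s': "prod_convolution_semigroup \<sigma>'" "\<sigma>' 1 = \<sigma> 1" and c: "0 < c" for \<sigma>' c
  proof (rule prod_convolution_semigroup_eqI[OF semi s'(1) _ c])
    fix p
    define q where "q = 1 / real (Suc p)"
    have q: "0 < q" "q \<le> 1" by (auto simp: q_def)
    have p': "prob_on {0<..} (\<sigma>' q)" using s'(1) q by (simp add: prod_convolution_semigroup_def)
    have "prod_convolution_power (\<sigma>' q) (Suc p) = \<sigma> 1"
      using prod_convolution_semigroup_power[OF s'(1) q(1), of p] s'(2) by (simp add: q_def)
    then have "has_moments (\<sigma>' q) (\<lambda>n. s n powr q)"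
      unfolding q_def using p' mom1 spos by (intro has_moments_convolution_root) (simp_all add: q_def)
    moreover have "s n powr q \<le> K ^ n * fact n" for n
    proof (cases "s n \<le> 1")
      case True
      then have "s n powr q \<le> 1" using spos[of n] q by (intro powr_le1) auto
      also have "1 \<le> K ^ n * fact n"
        using K(1) mult_mono[of 1 "K ^ n" 1 "fact n"] by (simp add: one_le_power fact_ge_1)
      finally show ?thesis .
    next
      case False
      then have "s n powr q \<le> s n powr 1" using q by (intro powr_mono) auto
      also have "\<dots> \<le> K ^ n * fact n" using K(2)[of n] spos[of n] by simp
      finally show ?thesis .
    qed
    ultimately have "\<sigma>' q = \<sigma> q"
      using K(1) by (intro stieltjes_moment_determinacy[OF weaken[OF p'] weaken[OF pos[OF q(1)]] _ mom[OF q(1)], of K]) auto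
    then show "\<sigma>' (1 / real (Suc p)) = \<sigma> (1 / real (Suc p))" by (simp only: q_def)
  qed
  have mellin: "integrable \<kappa> (mellin_integrand \<alpha> \<beta> z)"
    "0 < c \<Longrightarrow> has_bochner_integral (\<sigma> c) (\<lambda>t. complex_of_real t powr z)
      (exp (- of_real c * mellin_exponent f \<alpha> \<beta> \<kappa> z))" if z: "0 \<le> Re z" for z c
  proof -
    show "integrable \<kappa> (mellin_integrand \<alpha> \<beta> z)" by (rule B.mellin_exponent_eq(1)[OF \<beta> z])
    assume "0 < c"
    from \<sigma>[OF this] z show "has_bochner_integral (\<sigma> c) (\<lambda>t. complex_of_real t powr z)
        (exp (- of_real c * mellin_exponent f \<alpha> \<beta> \<kappa> z))"
      by (simp add: has_mellin_def E_def)
  qed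
  show ?thesis
    unfolding s_def[symmetric]
  proof (intro conjI allI impI)
    show "\<exists>!\<rho>. prob_on {0..} \<rho> \<and> has_moments \<rho> s"
      using uniq mom1 weaken[OF pos[of 1]] by auto
    fix \<rho> assume \<rho>: "prob_on {0..} \<rho> \<and> has_moments \<rho> s"
    then have r: "\<rho> = \<sigma> 1" using uniq by blast
    show "borel_measure_on {0<..} \<rho>" using pos[of 1] by (simp add: r prob_on_def)
    show "prod_infinitely_divisible \<rho>" unfolding r by (rule prod_infinitely_divisible_semigroup_1[OF semi])
    show "\<exists>\<sigma>. prod_convolution_semigroup \<sigma> \<and> \<sigma> 1 = \<rho> \<and>
        (\<forall>\<sigma>'. prod_convolution_semigroup \<sigma>' \<and> \<sigma>' 1 = \<rho> \<longrightarrow> (\<forall>c>0. \<sigma>' c = \<sigma> c)) \<and>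
        (\<forall>c>0. has_moments (\<sigma> c) (\<lambda>n. s n powr c)) \<and>
        (\<forall>z. Re z \<ge> 0 \<longrightarrow>
          integrable \<kappa> (mellin_integrand \<alpha> \<beta> z) \<and>
          (\<forall>c>0. has_bochner_integral (\<sigma> c) (\<lambda>t. complex_of_real t powr z)
            (exp (- of_real c * mellin_exponent f \<alpha> \<beta> \<kappa> z))))"
    proof (intro exI[of _ \<sigma>] conjI allI impI)
      show "prod_convolution_semigroup \<sigma>" by (rule semi)
      show "\<sigma> 1 = \<rho>" by (rule r[symmetric])
      show "\<sigma>' c = \<sigma> c" if "prod_convolution_semigroup \<sigma>' \<and> \<sigma>' 1 = \<rho>" "0 < c" for \<sigma>' c
        using that semi_uniq r by blast
      show "has_moments (\<sigma> c) (\<lambda>n. s n powr c)" if "0 < c" for c by (rule mom[OF that])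
      show "integrable \<kappa> (mellin_integrand \<alpha> \<beta> z)" if "0 \<le> Re z" for z
        using that by (rule mellin)
      show "has_bochner_integral (\<sigma> c) (\<lambda>t. complex_of_real t powr z)
          (exp (- of_real c * mellin_exponent f \<alpha> \<beta> \<kappa> z))" if "0 \<le> Re z" "0 < c" for z c
        using that by (rule mellin)
    qed
  qed
qed

end
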